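(* Let $(\mathcal M,\mathcal D)$ be a Cartan pair with conditional expectation $E:\mathcal M\to\mathcal D$, and let $u,v\in\mathcal{GN}(\mathcal M,\mathcal D)$. The following are equivalent: (a) $u\leq_{\mathcal D}v$, i.e. there is $d\in\mathcal D$ such that $u=vd$; (b) $u=vE(v^*u)$; (c) $P_u\leq P_v$, where $P_w$ denotes the support projection of $w\in\mathcal{GN}(\mathcal M,\mathcal D)$.
   Context: A MASA (maximal abelian self-adjoint subalgebra) $\mathcal D$ of a von Neumann algebra $\mathcal M$ is Cartan if (i) there is a faithful normal conditional expectation $E:\mathcal M\to\mathcal D$, and (ii) $\operatorname{span}\{U\in\mathcal M: U \text{ unitary},\ U\mathcal D U^*=\mathcal D\}$ is $\sigma$-weakly dense in $\mathcal M$. Then $(\mathcal M,\mathcal D)$ is called a Cartan pair. No separability is assumed. $\mathcal{GN}(\mathcal M,\mathcal D)$ is the set of partial isometries $v\in\mathcal M$ with $v^*\mathcal D v\cup v\mathcal D v^*\subseteq\mathcal D$. Fix a faithful normal semi-finite weight $\phi$ on $\mathcal M$ with $\phi\circ E=\phi$; let $\mathfrak n_\phi=\{x\in\mathcal M:\phi(x^*x)<\infty\}$ and let $(\pi_\phi,\mathfrak H_\phi,\eta_\phi)$ be the semi-cyclic (GNS) representation, so $\eta_\phi:\mathfrak n_\phi\to\mathfrak H_\phi$ is linear with dense range, $\langle\eta_\phi(x),\eta_\phi(y)\rangle=\phi(y^*x)$ and $\pi_\phi(a)\eta_\phi(x)=\eta_\phi(ax)$. With $J$ the modular conjugation, put $\pi_\ell(d)=\pi_\phi(d)$,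 $\pi_r(d)=J\pi_\phi(d^* )J$ for $d\in\mathcal D$, and $\mathcal Z=(\pi_\ell(\mathcal D)\cup\pi_r(\mathcal D))''$, which is known to be a MASA in $\mathcal B(\mathfrak H_\phi)$. A $\mathcal D$-bimodule in $\mathcal M$ is a linear subspace $\mathcal S\subseteq\mathcal M$ with $\mathcal D\mathcal S\mathcal D\subseteq\mathcal S$. The Bures topology on $\mathcal M$ is generated by the seminorms $T\mapsto\sqrt{\tau(E(T^*T))}$, $\tau\in(\mathcal D_* )^+$. The support of a $\sigma$-weakly closed $\mathcal D$-bimodule $\mathcal S$ is the orthogonal projection $\operatorname{supp}(\mathcal S)\in\mathcal Z$ onto $\overline{\pi_\phi(\mathcal S)\eta_\phi(\mathfrak n_\phi\cap\mathcal D)}$; for $T\in\mathcal M$, $\operatorname{supp}(T)$ is the support of the Bures-closed $\mathcal D$-bimodule generated by $T$. For $w\in\mathcal{GN}(\mathcal M,\mathcal D)$, $P_w:=\operatorname{supp}(w)$. It is known that $P_w$ is the orthogonal projection onto $\overline{\{\eta_\phi(wd):d\in\mathfrak n_\phi\cap\mathcal D\}}$ and that $P_w\eta_\phi(x)=\eta_\phi(wE(w^*x))$ for $x\in\mathfrak n_\phi$. *)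

theory Defs
  imports "HOL-Analysis.Analysis"
begin

section \<open>Complex Hilbert spaces\<close>

text \<open>The inner product is linear in the first argument. The norm is the one of the underlying
  real inner product space, so that \<open>(norm x)\<^sup>2 = Re (cinner x x)\<close>. There is no restriction on the
  dimension; in particular, separability is not assumed.\<close>

class complex_hilbert_space = real_inner + complete_space +
  fixes scaleC :: "complex \<Rightarrow> 'a \<Rightarrow> 'a"  (infixr \<open>*\<^sub>C\<close> 75)
    and cinner :: "'a \<Rightarrow> 'a \<Rightarrow> complex"
  assumes scaleC_add_right: "a *\<^sub>C (x + y) = a *\<^sub>C x + a *\<^sub>C y"
    and scaleC_add_left: "(a + b) *\<^sub>C x = a *\<^sub>C x + b *\<^sub>C x"
    and scaleC_scaleC: "a *\<^sub>C b *\<^sub>C x = (a * b) *\<^sub>C x"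
    and scaleC_one: "1 *\<^sub>C x = x"
    and scaleR_scaleC: "r *\<^sub>R x = complex_of_real r *\<^sub>C x"
    and cinner_commute: "cinner x y = cnj (cinner y x)"
    and cinner_add_left: "cinner (x + y) z = cinner x z + cinner y z"
    and cinner_scaleC_left: "cinner (a *\<^sub>C x) y = a * cinner x y"
    and inner_eq_Re_cinner: "inner x y = Re (cinner x y)"

lemma norm_scaleC: "norm (a *\<^sub>C (x::'a::complex_hilbert_space)) = cmod a * norm x"
proof -
  have "cinner (a *\<^sub>C x) (a *\<^sub>C x) = (a * cnj a) * cinner x x"
    by (metis cinner_commute cinner_scaleC_left complex_cnj_mult mult.assoc mult.left_commute)
  also have "\<dots> = complex_of_real ((cmod a)\<^sup>2) * cinner x x"
    by (simp only: complex_norm_square)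
  finally have "inner (a *\<^sub>C x) (a *\<^sub>C x) = (cmod a)\<^sup>2 * inner x x"
    by (simp add: inner_eq_Re_cinner)
  then show ?thesis
    by (simp add: norm_eq_sqrt_inner real_sqrt_mult)
qed

lemma bounded_linear_scaleC: "bounded_linear (\<lambda>x::'a::complex_hilbert_space. a *\<^sub>C x)"
  by (rule bounded_linear_intro[where K = "cmod a"])
    (simp_all add: scaleC_add_right scaleR_scaleC scaleC_scaleC norm_scaleC mult.commute)

interpretation hilb: vector_space "scaleC :: complex \<Rightarrow> 'a \<Rightarrow> 'a::complex_hilbert_space"
  by unfold_locales (simp_all add: scaleC_add_right scaleC_add_left scaleC_scaleC scaleC_one)


section \<open>Bounded operators\<close>

text \<open>The type \<open>'a \<Rightarrow>\<^sub>L 'a\<close> consists of the bounded real-linear maps; the bounded operators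
  in the sense of the theory of complex Hilbert spaces form the following subset.\<close>

definition bounded_ops :: "('a::complex_hilbert_space \<Rightarrow>\<^sub>L 'a) set" where
  "bounded_ops = {T. \<forall>c x. blinfun_apply T (c *\<^sub>C x) = c *\<^sub>C blinfun_apply T x}"

definition scale_op :: "complex \<Rightarrow> ('a::complex_hilbert_space \<Rightarrow>\<^sub>L 'a) \<Rightarrow> ('a \<Rightarrow>\<^sub>L 'a)" where
  "scale_op c T = Blinfun (\<lambda>x. c *\<^sub>C blinfun_apply T x)"

lemma scale_op_apply: "blinfun_apply (scale_op c T) x = c *\<^sub>C blinfun_apply T x"
  unfolding scale_op_def
  by (subst bounded_linear_Blinfun_apply)
    (auto intro: bounded_linear_compose[OF bounded_linear_scaleC blinfun.bounded_linear_right])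

interpretation op: vector_space "scale_op :: complex \<Rightarrow> ('a::complex_hilbert_space \<Rightarrow>\<^sub>L 'a) \<Rightarrow> _"
  by unfold_locales
    (auto intro!: blinfun_eqI simp: scale_op_apply blinfun.add_left scaleC_add_right
      scaleC_add_left scaleC_scaleC scaleC_one)

definition op_adj :: "('a::complex_hilbert_space \<Rightarrow>\<^sub>L 'a) \<Rightarrow> ('a \<Rightarrow>\<^sub>L 'a)" where
  "op_adj T = (THE S. S \<in> bounded_ops \<and>
     (\<forall>x y. cinner (blinfun_apply T x) y = cinner x (blinfun_apply S y)))"

definition positive_op :: "('a::complex_hilbert_space \<Rightarrow>\<^sub>L 'a) \<Rightarrow> bool" where
  "positive_op T \<longleftrightarrow> T \<in> bounded_ops \<and> (\<forall>x. cinner (blinfun_apply T x) x \<in> \<real>\<^sub>\<ge>\<^sub>0)"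

definition op_le :: "('a::complex_hilbert_space \<Rightarrow>\<^sub>L 'a) \<Rightarrow> ('a \<Rightarrow>\<^sub>L 'a) \<Rightarrow> bool" where
  "op_le S T \<longleftrightarrow> positive_op (T - S)"

definition projection :: "('a::complex_hilbert_space \<Rightarrow>\<^sub>L 'a) \<Rightarrow> bool" where
  "projection P \<longleftrightarrow> P \<in> bounded_ops \<and> P o\<^sub>L P = P \<and> op_adj P = P"

definition proj_onto :: "'a set \<Rightarrow> ('a::complex_hilbert_space \<Rightarrow>\<^sub>L 'a)" where
  "proj_onto K = (THE P. projection P \<and> range (blinfun_apply P) = K)"

definition partial_isometry :: "('a::complex_hilbert_space \<Rightarrow>\<^sub>L 'a) \<Rightarrow> bool" where
  "partial_isometry V \<longleftrightarrow> V \<in> bounded_ops \<and> projection (op_adj V o\<^sub>L V)"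

definition unitary_op :: "('a::complex_hilbert_space \<Rightarrow>\<^sub>L 'a) \<Rightarrow> bool" where
  "unitary_op U \<longleftrightarrow> U \<in> bounded_ops \<and>
     op_adj U o\<^sub>L U = id_blinfun \<and> U o\<^sub>L op_adj U = id_blinfun"

text \<open>Complex linearity of a map on a complex linear subspace \<open>X\<close>, where \<open>sc1\<close> and \<open>sc2\<close> are the
  scalar multiplications of the domain and of the codomain.\<close>

definition clinear_on ::
  "'a::ab_group_add set \<Rightarrow> (complex \<Rightarrow> 'a \<Rightarrow> 'a) \<Rightarrow> (complex \<Rightarrow> 'b::ab_group_add \<Rightarrow> 'b) \<Rightarrow>
    ('a \<Rightarrow> 'b) \<Rightarrow> bool" where
  "clinear_on X sc1 sc2 f \<longleftrightarrow>
     (\<forall>x\<in>X. \<forall>y\<in>X. f (x + y) = f x + f y) \<and> (\<forall>c. \<forall>x\<in>X. f (sc1 c x) = sc2 c (f x))"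


section \<open>Topologies\<close>

text \<open>The topology on \<open>X\<close> generated by a family of seminorms: the open balls are a subbasis.\<close>

definition seminorm_topology :: "'a::ab_group_add set \<Rightarrow> ('a \<Rightarrow> real) set \<Rightarrow> 'a topology" where
  "seminorm_topology X P =
     topology_generated_by {{y \<in> X. p (y - x) < r} | p x r. p \<in> P \<and> x \<in> X \<and> 0 < r}"

definition sigma_weak :: "('a::complex_hilbert_space \<Rightarrow>\<^sub>L 'a) topology" where
  "sigma_weak = seminorm_topology bounded_ops
     {\<lambda>T. cmod (\<Sum>n. cinner (blinfun_apply T (\<xi> n)) (\<zeta> n)) | \<xi> \<zeta> :: nat \<Rightarrow> 'a.
        summable (\<lambda>n. (norm (\<xi> n))\<^sup>2) \<and> summable (\<lambda>n. (norm (\<zeta> n))\<^sup>2)}"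


section \<open>Von Neumann algebras, MASAs, Cartan pairs\<close>

definition commutant :: "('a::complex_hilbert_space \<Rightarrow>\<^sub>L 'a) set \<Rightarrow> ('a \<Rightarrow>\<^sub>L 'a) set" where
  "commutant S = {T \<in> bounded_ops. \<forall>A\<in>S. T o\<^sub>L A = A o\<^sub>L T}"

definition star_subalgebra :: "('a::complex_hilbert_space \<Rightarrow>\<^sub>L 'a) set \<Rightarrow> bool" where
  "star_subalgebra A \<longleftrightarrow> A \<subseteq> bounded_ops \<and> op.subspace A \<and>
     (\<forall>S\<in>A. \<forall>T\<in>A. S o\<^sub>L T \<in> A) \<and> (\<forall>T\<in>A. op_adj T \<in> A)"

definition von_neumann_algebra :: "('a::complex_hilbert_space \<Rightarrow>\<^sub>L 'a) set \<Rightarrow> bool" where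
  "von_neumann_algebra M \<longleftrightarrow> star_subalgebra M \<and> commutant (commutant M) = M"

definition abelian_star_subalgebra :: "('a::complex_hilbert_space \<Rightarrow>\<^sub>L 'a) set \<Rightarrow> bool" where
  "abelian_star_subalgebra A \<longleftrightarrow> star_subalgebra A \<and> (\<forall>S\<in>A. \<forall>T\<in>A. S o\<^sub>L T = T o\<^sub>L S)"

definition masa ::
  "('a::complex_hilbert_space \<Rightarrow>\<^sub>L 'a) set \<Rightarrow> ('a \<Rightarrow>\<^sub>L 'a) set \<Rightarrow> bool" where
  "masa M D \<longleftrightarrow> abelian_star_subalgebra D \<and> D \<subseteq> M \<and>
     (\<forall>B. abelian_star_subalgebra B \<and> D \<subseteq> B \<and> B \<subseteq> M \<longrightarrow> B = D)"

definition conditional_expectation ::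
  "('a::complex_hilbert_space \<Rightarrow>\<^sub>L 'a) set \<Rightarrow> ('a \<Rightarrow>\<^sub>L 'a) set \<Rightarrow> (('a \<Rightarrow>\<^sub>L 'a) \<Rightarrow> ('a \<Rightarrow>\<^sub>L 'a)) \<Rightarrow> bool"
  where
  "conditional_expectation M D E \<longleftrightarrow>
     E ` M \<subseteq> D \<and> clinear_on M scale_op scale_op E \<and>
     (\<forall>d\<in>D. E d = d) \<and>
     (\<forall>x\<in>M. positive_op x \<longrightarrow> positive_op (E x)) \<and>
     (\<forall>c\<in>D. \<forall>d\<in>D. \<forall>x\<in>M. E (c o\<^sub>L x o\<^sub>L d) = c o\<^sub>L E x o\<^sub>L d)"

definition faithful_normal_conditional_expectation ::
  "('a::complex_hilbert_space \<Rightarrow>\<^sub>L 'a) set \<Rightarrow> ('a \<Rightarrow>\<^sub>L 'a) set \<Rightarrow> (('a \<Rightarrow>\<^sub>L 'a) \<Rightarrow> ('a \<Rightarrow>\<^sub>L 'a)) \<Rightarrow> bool"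
  where
  "faithful_normal_conditional_expectation M D E \<longleftrightarrow>
     conditional_expectation M D E \<and>
     (\<forall>x\<in>M. positive_op x \<and> E x = 0 \<longrightarrow> x = 0) \<and>
     continuous_map (subtopology sigma_weak M) (subtopology sigma_weak D) E"

definition unitary_normalizer ::
  "('a::complex_hilbert_space \<Rightarrow>\<^sub>L 'a) set \<Rightarrow> ('a \<Rightarrow>\<^sub>L 'a) set \<Rightarrow> ('a \<Rightarrow>\<^sub>L 'a) set" where
  "unitary_normalizer M D = {U \<in> M. unitary_op U \<and> (\<lambda>d. U o\<^sub>L d o\<^sub>L op_adj U) ` D = D}"

definition cartan_pair ::
  "('a::complex_hilbert_space \<Rightarrow>\<^sub>L 'a) set \<Rightarrow> ('a \<Rightarrow>\<^sub>L 'a) set \<Rightarrow> bool" where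
  "cartan_pair M D \<longleftrightarrow> von_neumann_algebra M \<and> masa M D \<and>
     (\<exists>E. faithful_normal_conditional_expectation M D E) \<and>
     M \<subseteq> sigma_weak closure_of (op.span (unitary_normalizer M D))"

definition groupoid_normalizer ::
  "('a::complex_hilbert_space \<Rightarrow>\<^sub>L 'a) set \<Rightarrow> ('a \<Rightarrow>\<^sub>L 'a) set \<Rightarrow> ('a \<Rightarrow>\<^sub>L 'a) set" where
  "groupoid_normalizer M D = {v \<in> M. partial_isometry v \<and>
     (\<forall>d\<in>D. op_adj v o\<^sub>L d o\<^sub>L v \<in> D) \<and> (\<forall>d\<in>D. v o\<^sub>L d o\<^sub>L op_adj v \<in> D)}"

definition normalizer_le :: "('a::complex_hilbert_space \<Rightarrow>\<^sub>L 'a) set \<Rightarrow> ('a \<Rightarrow>\<^sub>L 'a) \<Rightarrow> ('a \<Rightarrow>\<^sub>L 'a) \<Rightarrow> bool"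
  where
  "normalizer_le D u v \<longleftrightarrow> (\<exists>d\<in>D. u = v o\<^sub>L d)"


section \<open>Weights and their semi-cyclic representations\<close>

definition pos_part :: "('a::complex_hilbert_space \<Rightarrow>\<^sub>L 'a) set \<Rightarrow> ('a \<Rightarrow>\<^sub>L 'a) set" where
  "pos_part M = {x \<in> M. positive_op x}"

text \<open>A weight is an additive, positively homogeneous map from \<open>pos_part M\<close> to \<open>[0,\<infinity>]\<close>
  (with \<open>0 * \<infinity> = 0\<close>); its values outside \<open>pos_part M\<close> are irrelevant.\<close>

definition weight ::
  "('a::complex_hilbert_space \<Rightarrow>\<^sub>L 'a) set \<Rightarrow> (('a \<Rightarrow>\<^sub>L 'a) \<Rightarrow> ennreal) \<Rightarrow> bool" where
  "weight M \<phi> \<longleftrightarrow>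
     (\<forall>x\<in>pos_part M. \<forall>y\<in>pos_part M. \<phi> (x + y) = \<phi> x + \<phi> y) \<and>
     (\<forall>r\<ge>0. \<forall>x\<in>pos_part M. \<phi> (r *\<^sub>R x) = ennreal r * \<phi> x)"

definition faithful_weight ::
  "('a::complex_hilbert_space \<Rightarrow>\<^sub>L 'a) set \<Rightarrow> (('a \<Rightarrow>\<^sub>L 'a) \<Rightarrow> ennreal) \<Rightarrow> bool" where
  "faithful_weight M \<phi> \<longleftrightarrow> (\<forall>x\<in>pos_part M. \<phi> x = 0 \<longrightarrow> x = 0)"

text \<open>Normality: \<open>\<phi>\<close> preserves suprema of bounded increasing nets in \<open>pos_part M\<close>. Such a net
  may be replaced by the upward directed set \<open>F\<close> of its members; \<open>s\<close> is the supremum of \<open>F\<close>.\<close>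

definition normal_weight ::
  "('a::complex_hilbert_space \<Rightarrow>\<^sub>L 'a) set \<Rightarrow> (('a \<Rightarrow>\<^sub>L 'a) \<Rightarrow> ennreal) \<Rightarrow> bool" where
  "normal_weight M \<phi> \<longleftrightarrow>
     (\<forall>F s. F \<subseteq> pos_part M \<and> F \<noteq> {} \<and>
        (\<forall>x\<in>F. \<forall>y\<in>F. \<exists>z\<in>F. op_le x z \<and> op_le y z) \<and>
        s \<in> pos_part M \<and> (\<forall>x\<in>F. op_le x s) \<and>
        (\<forall>t\<in>pos_part M. (\<forall>x\<in>F. op_le x t) \<longrightarrow> op_le s t)
      \<longrightarrow> \<phi> s = (SUP x\<in>F. \<phi> x))"

definition weight_domain ::
  "('a::complex_hilbert_space \<Rightarrow>\<^sub>L 'a) set \<Rightarrow> (('a \<Rightarrow>\<^sub>L 'a) \<Rightarrow> ennreal) \<Rightarrow> ('a \<Rightarrow>\<^sub>L 'a) set" where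
  "weight_domain M \<phi> = op.span {x \<in> pos_part M. \<phi> x < \<infinity>}"

definition semifinite_weight ::
  "('a::complex_hilbert_space \<Rightarrow>\<^sub>L 'a) set \<Rightarrow> (('a \<Rightarrow>\<^sub>L 'a) \<Rightarrow> ennreal) \<Rightarrow> bool" where
  "semifinite_weight M \<phi> \<longleftrightarrow> M \<subseteq> sigma_weak closure_of (weight_domain M \<phi>)"

definition fns_weight ::
  "('a::complex_hilbert_space \<Rightarrow>\<^sub>L 'a) set \<Rightarrow> (('a \<Rightarrow>\<^sub>L 'a) \<Rightarrow> ennreal) \<Rightarrow> bool" where
  "fns_weight M \<phi> \<longleftrightarrow> weight M \<phi> \<and> faithful_weight M \<phi> \<and> normal_weight M \<phi> \<and> semifinite_weight M \<phi>"

definition left_ideal_of_weight ::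
  "('a::complex_hilbert_space \<Rightarrow>\<^sub>L 'a) set \<Rightarrow> (('a \<Rightarrow>\<^sub>L 'a) \<Rightarrow> ennreal) \<Rightarrow> ('a \<Rightarrow>\<^sub>L 'a) set" where
  "left_ideal_of_weight M \<phi> = {x \<in> M. \<phi> (op_adj x o\<^sub>L x) < \<infinity>}"

text \<open>The (unique) linear functional on the span of the positive elements of finite weight which
  extends \<open>\<phi>\<close>. It gives the meaning of \<open>\<phi> (y\<^sup>* x)\<close> when \<open>y\<^sup>* x\<close> is not positive.\<close>

definition linear_extension ::
  "('a::complex_hilbert_space \<Rightarrow>\<^sub>L 'a) set \<Rightarrow> (('a \<Rightarrow>\<^sub>L 'a) \<Rightarrow> ennreal) \<Rightarrow> (('a \<Rightarrow>\<^sub>L 'a) \<Rightarrow> complex) \<Rightarrow> bool"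
  where
  "linear_extension M \<phi> f \<longleftrightarrow> clinear_on (weight_domain M \<phi>) scale_op (*) f \<and>
     (\<forall>x\<in>pos_part M. \<phi> x < \<infinity> \<longrightarrow> f x = complex_of_real (enn2real (\<phi> x)))"

definition star_representation ::
  "('a::complex_hilbert_space \<Rightarrow>\<^sub>L 'a) set \<Rightarrow> (('a \<Rightarrow>\<^sub>L 'a) \<Rightarrow> ('b::complex_hilbert_space \<Rightarrow>\<^sub>L 'b)) \<Rightarrow> bool"
  where
  "star_representation M \<pi> \<longleftrightarrow> \<pi> ` M \<subseteq> bounded_ops \<and> clinear_on M scale_op scale_op \<pi> \<and>
     (\<forall>a\<in>M. \<forall>b\<in>M. \<pi> (a o\<^sub>L b) = \<pi> a o\<^sub>L \<pi> b) \<and> (\<forall>a\<in>M. \<pi> (op_adj a) = op_adj (\<pi> a))"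

text \<open>The Hilbert space of the representation is the type \<open>'b\<close>. The conditions determine
  \<open>(\<pi>, 'b, \<eta>)\<close> up to unitary equivalence.\<close>

definition semicyclic_representation ::
  "('a::complex_hilbert_space \<Rightarrow>\<^sub>L 'a) set \<Rightarrow> (('a \<Rightarrow>\<^sub>L 'a) \<Rightarrow> ennreal) \<Rightarrow>
    (('a \<Rightarrow>\<^sub>L 'a) \<Rightarrow> ('b::complex_hilbert_space \<Rightarrow>\<^sub>L 'b)) \<Rightarrow> (('a \<Rightarrow>\<^sub>L 'a) \<Rightarrow> 'b) \<Rightarrow> bool" where
  "semicyclic_representation M \<phi> \<pi> \<eta> \<longleftrightarrow>
     star_representation M \<pi> \<and>
     clinear_on (left_ideal_of_weight M \<phi>) scale_op scaleC \<eta> \<and>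
     closure (\<eta> ` left_ideal_of_weight M \<phi>) = UNIV \<and>
     (\<exists>f. linear_extension M \<phi> f \<and>
        (\<forall>x\<in>left_ideal_of_weight M \<phi>. \<forall>y\<in>left_ideal_of_weight M \<phi>.
           cinner (\<eta> x) (\<eta> y) = f (op_adj y o\<^sub>L x))) \<and>
     (\<forall>a\<in>M. \<forall>x\<in>left_ideal_of_weight M \<phi>. blinfun_apply (\<pi> a) (\<eta> x) = \<eta> (a o\<^sub>L x))"


section \<open>Bimodules and supports\<close>

definition bimodule ::
  "('a::complex_hilbert_space \<Rightarrow>\<^sub>L 'a) set \<Rightarrow> ('a \<Rightarrow>\<^sub>L 'a) set \<Rightarrow> ('a \<Rightarrow>\<^sub>L 'a) set \<Rightarrow> bool" where
  "bimodule M D S \<longleftrightarrow> S \<subseteq> M \<and> op.subspace S \<and> (\<forall>c\<in>D. \<forall>d\<in>D. \<forall>s\<in>S. c o\<^sub>L s o\<^sub>L d \<in> S)"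

text \<open>The positive part of the predual of \<open>D\<close>.\<close>

definition predual_pos ::
  "('a::complex_hilbert_space \<Rightarrow>\<^sub>L 'a) set \<Rightarrow> (('a \<Rightarrow>\<^sub>L 'a) \<Rightarrow> complex) set" where
  "predual_pos D = {\<tau>. clinear_on D scale_op (*) \<tau> \<and> (\<forall>d\<in>pos_part D. \<tau> d \<in> \<real>\<^sub>\<ge>\<^sub>0) \<and>
     continuous_map (subtopology sigma_weak D) euclidean \<tau>}"

definition bures_topology ::
  "('a::complex_hilbert_space \<Rightarrow>\<^sub>L 'a) set \<Rightarrow> ('a \<Rightarrow>\<^sub>L 'a) set \<Rightarrow> (('a \<Rightarrow>\<^sub>L 'a) \<Rightarrow> ('a \<Rightarrow>\<^sub>L 'a)) \<Rightarrow>
    ('a \<Rightarrow>\<^sub>L 'a) topology" where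
  "bures_topology M D E = seminorm_topology M
     {\<lambda>T. sqrt (Re (\<tau> (E (op_adj T o\<^sub>L T)))) | \<tau>. \<tau> \<in> predual_pos D}"

definition bures_closed_bimodule_generated ::
  "('a::complex_hilbert_space \<Rightarrow>\<^sub>L 'a) set \<Rightarrow> ('a \<Rightarrow>\<^sub>L 'a) set \<Rightarrow> (('a \<Rightarrow>\<^sub>L 'a) \<Rightarrow> ('a \<Rightarrow>\<^sub>L 'a)) \<Rightarrow>
    ('a \<Rightarrow>\<^sub>L 'a) \<Rightarrow> ('a \<Rightarrow>\<^sub>L 'a) set" where
  "bures_closed_bimodule_generated M D E T =
     \<Inter> {S. bimodule M D S \<and> closedin (bures_topology M D E) S \<and> T \<in> S}"

text \<open>The product of the sets \<open>\<pi> ` S\<close> and \<open>\<eta> ` (left_ideal_of_weight M \<phi> \<inter> D)\<close> in the definition of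
  the support is read as a span of products, as is usual for closed subspaces generated in this way.\<close>

definition supp_bimodule ::
  "('a::complex_hilbert_space \<Rightarrow>\<^sub>L 'a) set \<Rightarrow> ('a \<Rightarrow>\<^sub>L 'a) set \<Rightarrow> (('a \<Rightarrow>\<^sub>L 'a) \<Rightarrow> ennreal) \<Rightarrow>
    (('a \<Rightarrow>\<^sub>L 'a) \<Rightarrow> ('b::complex_hilbert_space \<Rightarrow>\<^sub>L 'b)) \<Rightarrow> (('a \<Rightarrow>\<^sub>L 'a) \<Rightarrow> 'b) \<Rightarrow>
    ('a \<Rightarrow>\<^sub>L 'a) set \<Rightarrow> ('b \<Rightarrow>\<^sub>L 'b)" where
  "supp_bimodule M D \<phi> \<pi> \<eta> S = proj_onto (closure (hilb.span
     {blinfun_apply (\<pi> s) (\<eta> d) | s d. s \<in> S \<and> d \<in> left_ideal_of_weight M \<phi> \<inter> D}))"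

definition supp_op ::
  "('a::complex_hilbert_space \<Rightarrow>\<^sub>L 'a) set \<Rightarrow> ('a \<Rightarrow>\<^sub>L 'a) set \<Rightarrow> (('a \<Rightarrow>\<^sub>L 'a) \<Rightarrow> ('a \<Rightarrow>\<^sub>L 'a)) \<Rightarrow>
    (('a \<Rightarrow>\<^sub>L 'a) \<Rightarrow> ennreal) \<Rightarrow>
    (('a \<Rightarrow>\<^sub>L 'a) \<Rightarrow> ('b::complex_hilbert_space \<Rightarrow>\<^sub>L 'b)) \<Rightarrow> (('a \<Rightarrow>\<^sub>L 'a) \<Rightarrow> 'b) \<Rightarrow>
    ('a \<Rightarrow>\<^sub>L 'a) \<Rightarrow> ('b \<Rightarrow>\<^sub>L 'b)" where
  "supp_op M D E \<phi> \<pi> \<eta> T =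
     supp_bimodule M D \<phi> \<pi> \<eta> (bures_closed_bimodule_generated M D E T)"

end

theory Submission
  imports Defs
begin

text \<open>Write \<open>R x = x - v E(v\<^sup>* x)\<close> for the residual of \<open>x\<close> with respect to a normalizer \<open>v\<close>; condition
  (b) says \<open>R u = 0\<close>. For the \<open>D\<close>-valued inner product \<open>E(y\<^sup>* x)\<close> on \<open>M\<close>, the map
  \<open>x \<mapsto> v E(v\<^sup>* x)\<close> is the orthogonal projection onto the part of \<open>M\<close> supported on \<open>v\<close>; it is a
  bimodule map, and \<open>R v = 0\<close> (\<open>residual_bimodule\<close>, \<open>residual_self\<close>). This gives the equivalence of (a)
  and (b): if \<open>u = v d\<close>, then \<open>R u = (R v) d = 0\<close>, and conversely \<open>d = E(v\<^sup>* u)\<close> will do.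

  Pythagoras, \<open>E((R x)\<^sup>* (R x)) \<le> E(x\<^sup>* x)\<close> (\<open>E_residual_le\<close>), makes \<open>R\<close> contractive in two ways. In the
  seminorms of the Bures topology it shows that the kernel of \<open>R\<close> is closed, so that this kernel
  contains the whole Bures-closed bimodule generated by \<open>v\<close> (\<open>residual_kernel_closed\<close>). In the norm of the
  semi-cyclic representation, by \<open>\<phi> \<circ> E = \<phi>\<close>, it shows that \<open>R y = 0\<close> whenever \<open>\<eta> y\<close> is a limit of
  vectors \<open>\<eta> x\<close> with \<open>R x = 0\<close>, hence whenever \<open>\<eta> y\<close> lies in the range of \<open>P\<^sub>v\<close>
  (\<open>residual_eq_0_of_support_space\<close>).

  For (c) note that the order of projections is the inclusion of their ranges. If \<open>u = v d\<close>, then \<open>u\<close>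
  lies in every bimodule containing \<open>v\<close>, so the range of \<open>P\<^sub>u\<close> is contained in that of \<open>P\<^sub>v\<close>. Conversely,
  assume this inclusion. For \<open>d\<close> in \<open>D\<close> with \<open>\<phi> (d\<^sup>* d) < \<infinity>\<close>, the vector \<open>\<eta> (u d)\<close> lies in the range of
  \<open>P\<^sub>v\<close>, so \<open>(R u) d = R (u d) = 0\<close>. These \<open>d\<close> include the expectations of all positive elements of
  finite weight; semi-finiteness of \<open>\<phi>\<close> and normality of \<open>E\<close> then give \<open>R u = 0\<close>
  (\<open>eq_0_if_annihilates_N_D\<close>).

  The orthogonal projections and adjoints used on the way come from the nearest point theorem in a
  complete inner product space (\<open>orthogonal_decomposition\<close>).\<close>

section \<open>Complex Hilbert spaces and adjoints\<close>

lemma cinner_add_right: "cinner x (y + z) = cinner x y + cinner (x::'a::complex_hilbert_space) z"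
  by (metis cinner_add_left cinner_commute complex_cnj_add)

lemma cinner_scaleC_right: "cinner x (a *\<^sub>C y) = cnj a * cinner (x::'a::complex_hilbert_space) y"
  by (metis cinner_commute cinner_scaleC_left complex_cnj_mult)

lemma cinner_diff_left: "cinner (x - y) z = cinner x z - cinner (y::'a::complex_hilbert_space) z"
  by (metis add_diff_cancel_right' cinner_add_left diff_add_cancel)

lemma cinner_diff_right: "cinner x (y - z) = cinner x y - cinner (x::'a::complex_hilbert_space) z"
  by (metis add_diff_cancel_right' cinner_add_right diff_add_cancel)

lemma cinner_zero_left [simp]: "cinner 0 (x::'a::complex_hilbert_space) = 0"
  using cinner_diff_left[of x x x] by simp

lemma cinner_zero_right [simp]: "cinner (x::'a::complex_hilbert_space) 0 = 0"
  using cinner_diff_right[of x x x] by simp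

lemma cinner_self: "cinner x x = complex_of_real ((norm (x::'a::complex_hilbert_space))\<^sup>2)"
proof (rule complex_eqI)
  show "Re (cinner x x) = Re (complex_of_real ((norm x)\<^sup>2))"
    by (simp add: inner_eq_Re_cinner[symmetric] power2_norm_eq_inner)
  show "Im (cinner x x) = Im (complex_of_real ((norm x)\<^sup>2))"
    using cinner_commute[of x x] by (metis Im_complex_of_real complex_cnj_cancel_iff Reals_cnj_iff complex_is_Real_iff)
qed

lemma cinner_eq_inner:
  "cinner x y = Complex (inner x y) (inner (x::'a::complex_hilbert_space) (\<i> *\<^sub>C y))"
  by (rule complex_eqI) (simp_all add: inner_eq_Re_cinner cinner_scaleC_right)

lemma inner_scaleC_left:
  "inner (c *\<^sub>C x) y = inner (x::'a::complex_hilbert_space) (cnj c *\<^sub>C y)"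
  by (simp add: inner_eq_Re_cinner cinner_scaleC_left cinner_scaleC_right)

lemma cinner_extensionality:
  assumes "\<And>y. cinner y x = cinner y (z::'a::complex_hilbert_space)"
  shows "x = z"
proof -
  have "cinner (x - z) (x - z) = 0" using assms by (simp add: cinner_diff_right)
  then show ?thesis by (simp add: cinner_self)
qed

text \<open>Addition and scalar multiplication are continuous, so they pass to limits of sequences.\<close>
lemma hilb_subspace_closure:
  fixes K :: "'a::complex_hilbert_space set"
  assumes "hilb.subspace K"
  shows "hilb.subspace (closure K)"
  unfolding hilb.subspace_def
proof (intro conjI ballI allI)
  show "0 \<in> closure K" using assms hilb.subspace_0 closure_subset by blast
next
  fix x y assume "x \<in> closure K" "y \<in> closure K"
  then obtain f g where fg: "\<forall>n. f n \<in> K" "f \<longlonglongrightarrow> x" "\<forall>n. g n \<in> K" "g \<longlonglongrightarrow> y"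
    unfolding closure_sequential by blast
  then have "(\<lambda>n. f n + g n) \<longlonglongrightarrow> x + y" "\<forall>n. f n + g n \<in> K"
    using hilb.subspace_add[OF assms] by (auto intro: tendsto_add)
  then show "x + y \<in> closure K" 
    unfolding closure_sequential by (intro exI[of _ "\<lambda>n. f n + g n"]) simp
next
  fix c x assume "x \<in> closure K"
  then obtain f where f: "\<forall>n. f n \<in> K" "f \<longlonglongrightarrow> x" unfolding closure_sequential by blast
  then have "(\<lambda>n. c *\<^sub>C f n) \<longlonglongrightarrow> c *\<^sub>C x" "\<forall>n. c *\<^sub>C f n \<in> K"
    using bounded_linear.tendsto[OF bounded_linear_scaleC] hilb.subspace_scale[OF assms] by blast+
  then show "c *\<^sub>C x \<in> closure K"
    unfolding closure_sequential by (intro exI[of _ "\<lambda>n. c *\<^sub>C f n"]) simp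
qed

text \<open>The nearest point of \<open>K\<close> to \<open>x\<close>. The sets of the points of \<open>K\<close> that are nearest up to
  \<open>1 / (n + 1)\<close> are closed and decreasing, and the parallelogram law makes their diameters shrink
  to zero; completeness gives a common point. Minimality of the distance along the lines in \<open>K\<close>
  through that point is orthogonality.\<close>
lemma orthogonal_decomposition:
  fixes K :: "'a::{real_inner,complete_space} set"
  assumes "closed K" and "subspace K"
  obtains k where "k \<in> K" and "\<And>y. y \<in> K \<Longrightarrow> inner (x - k) y = 0"
proof -
  define \<delta> where "\<delta> = infdist x K"
  have ne: "K \<noteq> {}" using assms(2) subspace_0 by blast
  have \<delta>0: "\<delta> \<ge> 0" by (simp add: \<delta>_def infdist_nonneg)
  have low: "\<delta> \<le> norm (x - k)" if "k \<in> K" for k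
    using infdist_le[OF that, of x] by (simp add: \<delta>_def dist_norm)
  define S where "S n = {k \<in> K. norm (x - k) \<le> \<delta> + inverse (real (Suc n))}" for n
  have "\<exists>a. \<forall>n. a \<in> S n"
  proof (rule decreasing_closed_nest)
    fix n
    have "continuous_on UNIV (\<lambda>k. norm (x - k))" by (intro continuous_intros)
    then have "closed {k. norm (x - k) \<le> \<delta> + inverse (real (Suc n))}"
      by (intro closed_Collect_le) auto
    then show "closed (S n)"
      unfolding S_def Collect_conj_eq using assms(1) by auto
    have "\<exists>k\<in>K. dist x k < \<delta> + inverse (real (Suc n))"
    proof (rule ccontr)
      assume "\<not> ?thesis"
      then have "\<delta> + inverse (real (Suc n)) \<le> infdist x K"
        unfolding infdist_notempty[OF ne] by (intro cINF_greatest ne) auto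
      moreover have "0 < inverse (real (Suc n))" by simp
      ultimately show False unfolding \<delta>_def by linarith
    qed
    then show "S n \<noteq> {}" by (auto simp: S_def dist_norm intro: less_imp_le)
  next
    fix m n :: nat assume "m \<le> n"
    then have "inverse (real (Suc n)) \<le> inverse (real (Suc m))" by simp
    then show "S n \<subseteq> S m" unfolding S_def by (auto intro: order_trans)
  next
    fix e :: real assume e: "0 < e"
    have "(\<lambda>n. 4 * ((\<delta> + inverse (real (Suc n)))\<^sup>2 - \<delta>\<^sup>2)) \<longlonglongrightarrow> 4 * ((\<delta> + 0)\<^sup>2 - \<delta>\<^sup>2)"
      by (intro tendsto_intros LIMSEQ_inverse_real_of_nat)
    then have "\<forall>\<^sub>F n in sequentially. 4 * ((\<delta> + inverse (real (Suc n)))\<^sup>2 - \<delta>\<^sup>2) < e\<^sup>2"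
      by (rule order_tendstoD) (use e in simp)
    then obtain n where n: "4 * ((\<delta> + inverse (real (Suc n)))\<^sup>2 - \<delta>\<^sup>2) < e\<^sup>2"
      using eventually_sequentially by auto
    have "dist a b < e" if a: "a \<in> S n" and b: "b \<in> S n" for a b
    proof -
      let ?m = "(1/2) *\<^sub>R (a + b)"
      have "?m \<in> K"
        using a b assms(2) unfolding S_def by (auto intro: subspace_scale subspace_add)
      then have m: "\<delta>\<^sup>2 \<le> (norm (x - ?m))\<^sup>2" using low \<delta>0 by (simp add: power_mono)
      have na: "(norm (x - a))\<^sup>2 \<le> (\<delta> + inverse (real (Suc n)))\<^sup>2"
        and nb: "(norm (x - b))\<^sup>2 \<le> (\<delta> + inverse (real (Suc n)))\<^sup>2"
        using a b unfolding S_def by (auto intro: power_mono)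
      have "(norm (a - b))\<^sup>2 =
          2 * (norm (x - a))\<^sup>2 + 2 * (norm (x - b))\<^sup>2 - 4 * (norm (x - ?m))\<^sup>2"
        unfolding power2_norm_eq_inner
        by (simp add: inner_diff_left inner_diff_right inner_add_left inner_add_right
            inner_commute algebra_simps)
      then have "(norm (a - b))\<^sup>2 < e\<^sup>2" using m na nb n by argo
      then show ?thesis using e by (simp add: dist_norm power2_less_imp_less)
    qed
    then show "\<exists>n. \<forall>a\<in>S n. \<forall>b\<in>S n. dist a b < e" by blast
  qed blast
  then obtain k where k: "\<And>n. k \<in> S n" by blast
  then have kK: "k \<in> K" by (simp add: S_def)
  have "(\<lambda>n. \<delta> + inverse (real (Suc n))) \<longlonglongrightarrow> \<delta> + 0"
    by (intro tendsto_intros LIMSEQ_inverse_real_of_nat)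
  then have knorm: "norm (x - k) \<le> \<delta>"
    using k by (intro LIMSEQ_le_const) (auto simp: S_def)
  have "inner (x - k) y = 0" if y: "y \<in> K" for y
  proof (cases "y = 0")
    case False
    \<comment> \<open>the minimizer of the quadratic function \<open>t \<mapsto> \<parallel>x - k - t y\<parallel>\<^sup>2\<close>\<close>
    define t where "t = inner (x - k) y / (norm y)\<^sup>2"
    have "k + t *\<^sub>R y \<in> K" using kK y assms(2) by (auto intro: subspace_scale subspace_add)
    then have "norm (x - k) \<le> norm (x - (k + t *\<^sub>R y))" using low knorm by force
    then have "(norm (x - k))\<^sup>2 \<le> (norm (x - (k + t *\<^sub>R y)))\<^sup>2" by (simp add: power_mono)
    also have "\<dots> = (norm (x - k))\<^sup>2 - 2 * t * inner (x - k) y + t\<^sup>2 * (norm y)\<^sup>2"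
      unfolding power2_norm_eq_inner
      by (simp add: inner_diff_left inner_diff_right inner_add_left inner_add_right
          inner_commute algebra_simps power2_eq_square)
    also have "\<dots> = (norm (x - k))\<^sup>2 - (inner (x - k) y)\<^sup>2 / (norm y)\<^sup>2"
      using False by (simp add: t_def power2_eq_square field_simps)
    finally have "(inner (x - k) y)\<^sup>2 / (norm y)\<^sup>2 \<le> 0" by simp
    then show ?thesis using False by (simp add: divide_le_0_iff)
  qed simp
  with kK show ?thesis using that by blast
qed

text \<open>The kernel of a non-zero \<open>f\<close> has codimension one, so a vector \<open>b\<close> orthogonal to it represents \<open>f\<close>
  up to a factor.\<close>
lemma riesz_representation:
  fixes f :: "'a::{real_inner,complete_space} \<Rightarrow> real"
  assumes "bounded_linear f"
  obtains z where "\<And>x. f x = inner x z"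
proof (cases "\<forall>x. f x = 0")
  case True
  then show ?thesis using that[of 0] by simp
next
  case False
  then obtain a where a: "f a \<noteq> 0" by blast
  interpret f: bounded_linear f by fact
  have cl: "closed {x. f x = 0}"
    by (intro closed_Collect_eq continuous_intros) (rule f.continuous_on, rule continuous_on_id)
  have sub: "subspace {x. f x = 0}"
    by (simp add: subspace_def f.add f.scaleR)
  obtain k where k: "f k = 0" and orth: "\<And>y. f y = 0 \<Longrightarrow> inner (a - k) y = 0"
    by (rule orthogonal_decomposition[OF cl sub, of a]) simp
  define b where "b = a - k"
  have fb: "f b \<noteq> 0" using a k by (simp add: b_def f.diff)
  then have b0: "b \<noteq> 0" using f.zero by auto
  have "f x = inner x ((f b / (norm b)\<^sup>2) *\<^sub>R b)" for x
  proof -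
    have "f (f b *\<^sub>R x - f x *\<^sub>R b) = 0" by (simp add: f.diff f.scaleR)
    then have "inner b (f b *\<^sub>R x - f x *\<^sub>R b) = 0" using orth b_def by blast
    then have "f b * inner x b = f x * (norm b)\<^sup>2"
      by (simp add: inner_diff_right power2_norm_eq_inner inner_commute)
    then show ?thesis using b0 by (simp add: field_simps)
  qed
  then show ?thesis using that by blast
qed

lemma bounded_opsI: "(\<And>c x. blinfun_apply T (c *\<^sub>C x) = c *\<^sub>C blinfun_apply T x) \<Longrightarrow> T \<in> bounded_ops"
  by (simp add: bounded_ops_def)

lemma bounded_opsD: "T \<in> bounded_ops \<Longrightarrow> T (c *\<^sub>C x) = c *\<^sub>C T x"
  by (simp add: bounded_ops_def)

text \<open>The Riesz theorem gives the adjoint for the real inner product. Since multiplication by \<open>c\<close>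
  has the adjoint \<open>cnj c\<close>, the adjoint of a complex linear operator is complex linear, and the
  complex inner product is determined by the real one.\<close>
lemma adjoint_exists:
  assumes T: "T \<in> bounded_ops"
  obtains S where "S \<in> bounded_ops" and "\<And>x y. cinner (T x) y = cinner x (S y)"
proof -
  have "\<exists>z. \<forall>x. inner (T x) y = inner x z" for y
  proof -
    have "bounded_linear (\<lambda>x. inner (T x) y)"
      by (rule bounded_linear_compose[OF bounded_linear_inner_left blinfun.bounded_linear_right])
    then show ?thesis by (metis riesz_representation)
  qed
  then obtain s where s: "\<And>x y. inner (T x) y = inner x (s y)" by metis
  have ext: "a = b" if "\<And>x. inner x a = inner x b" for a b :: 'a
    using that by (metis vector_eq_ldot)
  have "bounded_linear s"
  proof (rule bounded_linear_intro)
    show "s (x + y) = s x + s y" for x y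
      by (rule ext) (simp add: s[symmetric] inner_add_right)
    show "s (r *\<^sub>R x) = r *\<^sub>R s x" for r x
      by (rule ext) (simp add: s[symmetric])
    show "norm (s x) \<le> norm x * norm T" for x
    proof (cases "s x = 0")
      case False
      have "norm (s x) * norm (s x) = inner (T (s x)) x"
        by (simp add: s power2_norm_eq_inner[symmetric] power2_eq_square)
      also have "\<dots> \<le> norm (T (s x)) * norm x" by (rule norm_cauchy_schwarz)
      also have "\<dots> \<le> (norm T * norm (s x)) * norm x"
        by (intro mult_right_mono norm_blinfun) simp
      finally show ?thesis using False by (simp add: mult.commute mult.left_commute)
    qed simp
  qed
  then have bs: "blinfun_apply (Blinfun s) = s" by (rule bounded_linear_Blinfun_apply)
  have sc: "s (c *\<^sub>C y) = c *\<^sub>C s y" for c y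
  proof (rule ext)
    fix x
    have "inner x (s (c *\<^sub>C y)) = inner (cnj c *\<^sub>C T x) y"
      by (simp add: s[symmetric] inner_scaleC_left)
    also have "\<dots> = inner (cnj c *\<^sub>C x) (s y)"
      by (simp add: s[symmetric] bounded_opsD[OF T])
    also have "\<dots> = inner x (c *\<^sub>C s y)" by (simp add: inner_scaleC_left)
    finally show "inner x (s (c *\<^sub>C y)) = inner x (c *\<^sub>C s y)" .
  qed
  show ?thesis
  proof (rule that)
    show "Blinfun s \<in> bounded_ops" by (rule bounded_opsI) (simp add: bs sc)
    show "cinner (T x) y = cinner x (Blinfun s y)" for x y
      by (simp only: bs cinner_eq_inner s sc)
  qed
qed

lemma op_adj_unique:
  fixes S T :: "'a::complex_hilbert_space \<Rightarrow>\<^sub>L 'a"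
  assumes "S \<in> bounded_ops" and "\<And>x y. cinner (T x) y = cinner x (S y)"
  shows "op_adj T = S"
  unfolding op_adj_def
proof (rule the_equality)
  fix R assume R: "R \<in> bounded_ops \<and> (\<forall>x y. cinner (T x) y = cinner x (R y))"
  have "cinner x (R y) = cinner x (S y)" for x y using R assms(2)[of x y] by simp
  then show "R = S" by (intro blinfun_eqI cinner_extensionality)
qed (use assms in auto)

lemma op_adj_in [simp]: "T \<in> bounded_ops \<Longrightarrow> op_adj T \<in> bounded_ops"
  and op_adj_right: "T \<in> bounded_ops \<Longrightarrow> cinner x (op_adj T y) = cinner (T x) y"
proof -
  assume "T \<in> bounded_ops"
  then obtain S where S: "S \<in> bounded_ops" "\<And>x y. cinner (T x) y = cinner x (S y)"
    using adjoint_exists by blast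
  then have "op_adj T = S" by (rule op_adj_unique)
  with S show "op_adj T \<in> bounded_ops" "cinner x (op_adj T y) = cinner (T x) y" by auto
qed

lemma op_adj_left: "T \<in> bounded_ops \<Longrightarrow> cinner (op_adj T x) y = cinner x (T y)"
  by (simp only: cinner_commute[of "op_adj T x" y] cinner_commute[of x "T y"] op_adj_right)

lemma op_adj_adj [simp]: "T \<in> bounded_ops \<Longrightarrow> op_adj (op_adj T) = T"
  by (rule op_adj_unique) (auto simp: op_adj_left)

lemma bounded_ops_closed [simp]:
  assumes "S \<in> bounded_ops" and "T \<in> bounded_ops"
  shows "S o\<^sub>L T \<in> bounded_ops" "S + T \<in> bounded_ops" "S - T \<in> bounded_ops"
  using assms
  by (auto simp: bounded_ops_def blinfun.add_left blinfun.diff_left scaleC_add_right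
      hilb.scale_right_diff_distrib)

lemma id_bounded_op [simp]: "id_blinfun \<in> bounded_ops"
  by (simp add: bounded_ops_def)

lemma zero_bounded_op [simp]: "0 \<in> bounded_ops"
  by (simp add: bounded_ops_def)

lemma scale_bounded_op [simp]: "T \<in> bounded_ops \<Longrightarrow> scale_op c T \<in> bounded_ops"
  by (simp add: bounded_ops_def scale_op_apply scaleC_scaleC mult.commute)

lemma scaleR_eq_scale_op: "r *\<^sub>R T = scale_op (complex_of_real r) T"
  by (rule blinfun_eqI) (simp add: scale_op_apply scaleR_scaleC blinfun.scaleR_left)

lemma scaleR_bounded_op [simp]: "T \<in> bounded_ops \<Longrightarrow> r *\<^sub>R T \<in> bounded_ops"
  by (simp add: scaleR_eq_scale_op)

lemma op_adj_algebra:
  assumes "S \<in> bounded_ops" and "T \<in> bounded_ops"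
  shows "op_adj (S o\<^sub>L T) = op_adj T o\<^sub>L op_adj S"
    and "op_adj (S + T) = op_adj S + op_adj T"
    and "op_adj (S - T) = op_adj S - op_adj T"
  using assms
  by (auto intro!: op_adj_unique simp: op_adj_right blinfun.add_left blinfun.diff_left
      cinner_add_left cinner_add_right cinner_diff_left cinner_diff_right)

lemma op_adj_scale: "T \<in> bounded_ops \<Longrightarrow> op_adj (scale_op c T) = scale_op (cnj c) (op_adj T)"
  by (rule op_adj_unique)
    (simp_all add: op_adj_right scale_op_apply cinner_scaleC_left cinner_scaleC_right)

lemma op_adj_id [simp]: "op_adj id_blinfun = id_blinfun"
  by (rule op_adj_unique) auto

lemma op_adj_zero [simp]: "op_adj 0 = 0"
  by (rule op_adj_unique) auto

section \<open>Positive operators and projections\<close>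

lemma positive_op_iff:
  "positive_op T \<longleftrightarrow> T \<in> bounded_ops \<and> (\<forall>x. 0 \<le> Re (cinner (T x) x) \<and> Im (cinner (T x) x) = 0)"
  by (simp add: positive_op_def complex_nonneg_Reals_iff)

text \<open>Polarization: evaluate the real quadratic form at \<open>x + y\<close> and at \<open>x + \<i> y\<close>.\<close>
lemma positive_op_selfadjoint:
  assumes "positive_op T"
  shows "op_adj T = T"
proof (rule op_adj_unique)
  have T: "T \<in> bounded_ops" and im: "\<And>x. Im (cinner (T x) x) = 0"
    using assms by (auto simp: positive_op_iff)
  show "T \<in> bounded_ops" by (rule T)
  fix x y
  have "Im (cinner (T x) y) + Im (cinner (T y) x) = 0"
    using im[of "x + y"] im[of x] im[of y]
    by (simp add: blinfun.add_right cinner_add_left cinner_add_right)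
  moreover have "Re (cinner (T x) y) = Re (cinner (T y) x)"
    using im[of "x + \<i> *\<^sub>C y"] im[of x] im[of y]
    by (simp add: blinfun.add_right cinner_add_left cinner_add_right bounded_opsD[OF T]
        cinner_scaleC_left cinner_scaleC_right)
  ultimately show "cinner (T x) y = cinner x (T y)"
    by (subst cinner_commute[of x]) (simp add: complex_eq_iff)
qed

lemma selfadjoint_cinner_real:
  assumes "T \<in> bounded_ops" and "op_adj T = T"
  shows "Im (cinner (T x) x) = 0"
proof -
  have "cinner (T x) x = cnj (cinner (T x) x)"
    using op_adj_right[OF assms(1), of x x] cinner_commute[of x "T x"] assms(2) by simp
  then show ?thesis by (metis Reals_cnj_iff complex_is_Real_iff)
qed

lemma positive_adj_compose:
  assumes "T \<in> bounded_ops"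
  shows "positive_op (op_adj T o\<^sub>L T)"
  using assms by (simp add: positive_op_iff op_adj_left cinner_self)

lemma adj_compose_eq_0:
  assumes "T \<in> bounded_ops" and "op_adj T o\<^sub>L T = 0"
  shows "T = 0"
proof (rule blinfun_eqI)
  fix x
  have "cinner ((op_adj T o\<^sub>L T) x) x = 0" by (simp add: assms(2))
  then show "T x = blinfun_apply 0 x" using assms(1) by (simp add: op_adj_left cinner_self)
qed

text \<open>In operator form this is \<open>a\<^sup>2 \<le> \<parallel>a\<parallel> a\<close>. It makes the square of a positive element of finite
  weight have finite weight.\<close>
lemma positive_cauchy_schwarz:
  assumes "positive_op a"
  shows "(norm (a x))\<^sup>2 \<le> norm a * Re (cinner (a x) x)"
proof -
  have a: "a \<in> bounded_ops" "op_adj a = a" and pos: "\<And>x. 0 \<le> Re (cinner (a x) x)"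
    using assms positive_op_selfadjoint by (auto simp: positive_op_iff)
  define n where "n = (norm (a x))\<^sup>2"
  define p where "p = Re (cinner (a x) x)"
  define N where "N = norm a"
  have q: "Re (cinner (a (a x)) (a x)) \<le> N * n"
  proof -
    have "Re (cinner (a (a x)) (a x)) \<le> norm (a (a x)) * norm (a x)"
      using norm_cauchy_schwarz[of "a (a x)" "a x"] by (simp add: inner_eq_Re_cinner)
    also have "\<dots> \<le> (norm a * norm (a x)) * norm (a x)"
      by (intro mult_right_mono norm_blinfun) simp
    finally show ?thesis by (simp add: N_def n_def power2_eq_square mult.assoc)
  qed
  have sym: "cinner (a (a x)) x = complex_of_real n"
    using op_adj_right[OF a(1), of "a x" x] by (simp add: a cinner_self n_def)
  \<comment> \<open>positivity is tested at \<open>N x - a x\<close>, where the cubic term is at most \<open>N n\<close> by \<open>q\<close>\<close>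
  have "0 \<le> Re (cinner (a (N *\<^sub>R x - a x)) (N *\<^sub>R x - a x))" by (rule pos)
  also have "\<dots> = N\<^sup>2 * p - 2 * N * n + Re (cinner (a (a x)) (a x))"
    by (simp add: scaleR_scaleC blinfun.diff_right bounded_opsD[OF a(1)] cinner_diff_left
        cinner_diff_right cinner_scaleC_left cinner_scaleC_right sym p_def
        cinner_self n_def power2_eq_square algebra_simps)
  finally have "0 \<le> N * (N * p - n)" using q by (simp add: power2_eq_square algebra_simps)
  then show ?thesis
  proof (cases "N = 0")
    case False
    then have "0 < N" by (simp add: N_def)
    with \<open>0 \<le> N * (N * p - n)\<close> show ?thesis
      unfolding n_def[symmetric] p_def[symmetric] N_def[symmetric]
      by (simp add: zero_le_mult_iff)
  qed (simp add: N_def)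
qed

lemma op_leI:
  assumes "S \<in> bounded_ops" "T \<in> bounded_ops" "op_adj S = S" "op_adj T = T"
    and "\<And>x. Re (cinner (S x) x) \<le> Re (cinner (T x) x)"
  shows "op_le S T"
  using assms selfadjoint_cinner_real[of S] selfadjoint_cinner_real[of T]
  by (simp add: op_le_def positive_op_iff blinfun.diff_left cinner_diff_left)

lemma projectionD:
  assumes "projection P"
  shows "P \<in> bounded_ops" "P (P x) = P x" "cinner (P x) y = cinner x (P y)"
    and "Re (cinner (P x) x) = (norm (P x))\<^sup>2"
proof -
  show P: "P \<in> bounded_ops" and idem: "P (P x) = P x" for x
    using assms unfolding projection_def by (auto simp: blinfun_apply_blinfun_compose[symmetric]
        simp del: blinfun_apply_blinfun_compose)
  show sym: "cinner (P x) y = cinner x (P y)" for x y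
    using op_adj_right[OF P, of x y] assms by (simp add: projection_def)
  show "Re (cinner (P x) x) = (norm (P x))\<^sup>2"
    using sym[of "P x" x] idem[of x] by (simp add: cinner_self)
qed

lemma projection_fixes_range: "projection P \<Longrightarrow> x \<in> range P \<Longrightarrow> P x = x"
  by (auto simp: projectionD)

lemma projection_norm_le:
  assumes "projection P"
  shows "norm (P x) \<le> norm x"
proof (cases "P x = 0")
  case False
  have "norm (P x) * norm (P x) = inner (P x) x"
    using projectionD(4)[OF assms, of x] by (simp add: inner_eq_Re_cinner power2_eq_square)
  also have "\<dots> \<le> norm (P x) * norm x" by (rule norm_cauchy_schwarz)
  finally show ?thesis using False by simp
qed simp

lemma projection_exists:
  fixes K :: "'a::complex_hilbert_space set"
  assumes "closed K" and K: "hilb.subspace K"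
  obtains P where "projection P" and "range (blinfun_apply P) = K"
proof -
  have K': "subspace K"
    using K by (auto simp: subspace_def hilb.subspace_def scaleR_scaleC)
  have "\<exists>k. k \<in> K \<and> (\<forall>y\<in>K. inner (x - k) y = 0)" for x
    by (rule orthogonal_decomposition[OF assms(1) K', of x]) blast
  then obtain p where p: "\<And>x. p x \<in> K" and orth: "\<And>x y. y \<in> K \<Longrightarrow> inner (x - p x) y = 0"
    by metis
  have corth: "cinner (x - p x) y = 0" if "y \<in> K" for x y
    using that K by (simp add: cinner_eq_inner orth hilb.subspace_scale complex_eq_iff)
  have uniq: "p x = k" if k: "k \<in> K" "\<And>y. y \<in> K \<Longrightarrow> inner (x - k) y = 0" for x k
  proof -
    have d: "p x - k \<in> K" using p k K by (auto intro: hilb.subspace_diff)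
    have "inner (p x - k) (p x - k) = inner (x - k) (p x - k) - inner (x - p x) (p x - k)"
      by (simp add: inner_diff_left)
    also have "\<dots> = 0" using k(2)[OF d] orth[OF d] by simp
    finally show ?thesis by simp
  qed
  have add: "p (x + y) = p x + p y" for x y
  proof (rule uniq)
    show "p x + p y \<in> K" using p K by (auto intro: hilb.subspace_add)
    show "inner (x + y - (p x + p y)) z = 0" if "z \<in> K" for z
      using orth[OF that, of x] orth[OF that, of y] by (simp add: inner_diff_left inner_add_left)
  qed
  have scale: "p (c *\<^sub>C x) = c *\<^sub>C p x" for c x
  proof (rule uniq)
    show "c *\<^sub>C p x \<in> K" using p K by (auto intro: hilb.subspace_scale)
    show "inner (c *\<^sub>C x - c *\<^sub>C p x) z = 0" if "z \<in> K" for z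
      using corth[OF that, of x]
      by (simp add: inner_eq_Re_cinner cinner_scaleC_left hilb.scale_right_diff_distrib[symmetric])
  qed
  have fix_K: "p x = x" if "x \<in> K" for x
    by (rule uniq) (use that in auto)
  have "norm (p x) \<le> norm x * 1" for x
  proof (cases "p x = 0")
    case False
    have "norm (p x) * norm (p x) = inner x (p x)"
      using orth[OF p, of x x]
      by (simp add: inner_diff_left power2_norm_eq_inner[symmetric] power2_eq_square)
    also have "\<dots> \<le> norm x * norm (p x)" by (rule norm_cauchy_schwarz)
    finally show ?thesis using False by simp
  qed simp
  then have "bounded_linear p"
    by (intro bounded_linear_intro[where K = 1]) (simp_all add: add scale scaleR_scaleC)
  then have bp: "blinfun_apply (Blinfun p) = p" by (rule bounded_linear_Blinfun_apply)
  have b: "Blinfun p \<in> bounded_ops" by (simp add: bounded_ops_def bp scale)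
  have "cinner (p x) y = cinner x (p y)" for x y
  proof -
    have "cinner (p x) y = cinner (p x) (p y)"
      using corth[OF p, of y x] cinner_commute[of "p x" "y - p y"]
      by (simp add: cinner_diff_right)
    also have "\<dots> = cinner x (p y)"
      using corth[OF p, of x y] by (simp add: cinner_diff_left)
    finally show ?thesis .
  qed
  then have "op_adj (Blinfun p) = Blinfun p" by (intro op_adj_unique b) (simp add: bp)
  moreover have "Blinfun p o\<^sub>L Blinfun p = Blinfun p"
    by (rule blinfun_eqI) (simp add: bp fix_K p)
  ultimately have "projection (Blinfun p)" by (simp add: projection_def b)
  moreover have "range p = K" using p fix_K by (auto simp: image_iff) metis
  ultimately show ?thesis using that[of "Blinfun p"] bp by simp
qed

lemma projection_unique:
  assumes "projection P" "projection Q" and "range (blinfun_apply P) = range (blinfun_apply Q)"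
  shows "P = Q"
proof (rule blinfun_eqI, rule cinner_extensionality)
  fix x y
  have "Q (P x) = P x" "P (Q y) = Q y" using assms projection_fixes_range by blast+
  then show "cinner y (P x) = cinner y (Q x)"
    using projectionD(3)[OF assms(1)] projectionD(3)[OF assms(2)] by metis
qed

lemma proj_onto:
  assumes "closed K" and "hilb.subspace K"
  shows "projection (proj_onto K)" and "range (blinfun_apply (proj_onto K)) = K"
proof -
  obtain P where P: "projection P" "range (blinfun_apply P) = K"
    using projection_exists[OF assms] by blast
  then have "proj_onto K = P"
    unfolding proj_onto_def by (intro the_equality) (auto intro: projection_unique)
  with P show "projection (proj_onto K)" "range (blinfun_apply (proj_onto K)) = K" by auto
qed

text \<open>If \<open>P \<le> Q\<close> and \<open>P x = x\<close>, then \<open>\<parallel>x\<parallel> \<le> \<parallel>Q x\<parallel>\<close>, and Pythagoras gives \<open>Q x = x\<close>. Conversely, the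
  inclusion of the ranges gives \<open>P = P Q\<close>, so that \<open>\<parallel>P x\<parallel> \<le> \<parallel>Q x\<parallel>\<close>, which is the inequality of the
  quadratic forms.\<close>
lemma op_le_projection_iff:
  assumes P: "projection P" and Q: "projection Q"
  shows "op_le P Q \<longleftrightarrow> range (blinfun_apply P) \<subseteq> range (blinfun_apply Q)"
proof
  assume le: "op_le P Q"
  show "range (blinfun_apply P) \<subseteq> range (blinfun_apply Q)"
  proof
    fix x assume x: "x \<in> range (blinfun_apply P)"
    have "0 \<le> Re (cinner ((Q - P) x) x)"
      using le unfolding op_le_def positive_op_iff by blast
    also have "\<dots> = (norm (Q x))\<^sup>2 - (norm x)\<^sup>2"
      using projectionD(4)[OF Q, of x] projectionD(4)[OF P, of x] projection_fixes_range[OF P x]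
      by (simp add: blinfun.diff_left cinner_diff_left)
    finally have "(norm x)\<^sup>2 \<le> (norm (Q x))\<^sup>2" by simp
    moreover have "(norm (x - Q x))\<^sup>2 = (norm x)\<^sup>2 - (norm (Q x))\<^sup>2"
      using projectionD(4)[OF Q, of x] inner_commute[of x "Q x"]
      unfolding power2_norm_eq_inner
      by (simp add: inner_diff_left inner_diff_right inner_eq_Re_cinner
          cinner_diff_left cinner_diff_right)
    ultimately have "(norm (x - Q x))\<^sup>2 \<le> 0" by simp
    then have "x = Q x" by simp
    then show "x \<in> range (blinfun_apply Q)" by (metis rangeI)
  qed
next
  assume sub: "range (blinfun_apply P) \<subseteq> range (blinfun_apply Q)"
  have "P x = P (Q x)" for x
  proof (rule cinner_extensionality)
    fix y
    have "Q (P y) = P y" using sub projection_fixes_range[OF Q] by blast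
    then show "cinner y (P x) = cinner y (P (Q x))"
      using projectionD(3)[OF P] projectionD(3)[OF Q] by metis
  qed
  then have "norm (P x) \<le> norm (Q x)" for x by (metis projection_norm_le[OF P])
  then have "Re (cinner (P x) x) \<le> Re (cinner (Q x) x)" for x
    by (simp add: projectionD(4)[OF P] projectionD(4)[OF Q] power_mono)
  then show "op_le P Q"
    using P Q by (intro op_leI) (auto simp: projection_def)
qed

section \<open>Topologies generated by seminorms\<close>

lemma openin_seminorm_ball:
  assumes "p \<in> P" and "x \<in> X" and "0 < r"
  shows "openin (seminorm_topology X P) {y \<in> X. p (y - x) < r}"
  unfolding seminorm_topology_def by (rule topology_generated_by_Basis) (use assms in blast)

lemma topspace_seminorm_topology:
  assumes "p \<in> P" and "p 0 = 0"
  shows "topspace (seminorm_topology X P) = X"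
proof
  show "topspace (seminorm_topology X P) \<subseteq> X"
    unfolding seminorm_topology_def topology_generated_by_topspace by blast
  show "X \<subseteq> topspace (seminorm_topology X P)"
  proof
    fix x assume x: "x \<in> X"
    then have "x \<in> {y \<in> X. p (y - x) < 1}" using assms(2) by simp
    then show "x \<in> topspace (seminorm_topology X P)"
      using openin_subset[OF openin_seminorm_ball[OF assms(1) x, of 1]] by auto
  qed
qed

lemma continuous_map_seminorm_topology:
  fixes g :: "'a::ab_group_add \<Rightarrow> complex"
  assumes "(\<lambda>x. cmod (g x)) \<in> P" and "\<And>x y. g (y - x) = g y - g x"
  shows "continuous_map (seminorm_topology X P) euclidean g"
proof -
  have g0: "g 0 = 0" using assms(2)[of 0 0] by simp
  have top: "topspace (seminorm_topology X P) = X"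
    by (rule topspace_seminorm_topology[OF assms(1)]) (simp add: g0)
  have "openin (seminorm_topology X P) {x \<in> X. g x \<in> U}" if U: "open U" for U
  proof (subst openin_subopen, intro ballI)
    fix x assume "x \<in> {x \<in> X. g x \<in> U}"
    then have x: "x \<in> X" "g x \<in> U" by auto
    then obtain e where e: "0 < e" "ball (g x) e \<subseteq> U" using U openE by blast
    let ?B = "{y \<in> X. cmod (g (y - x)) < e}"
    have "openin (seminorm_topology X P) ?B"
      using openin_seminorm_ball[OF assms(1) x(1) e(1)] .
    moreover have "x \<in> ?B" using x e by (simp add: g0)
    moreover have "?B \<subseteq> {x \<in> X. g x \<in> U}"
      using e(2) by (auto simp: assms(2) dist_norm norm_minus_commute subset_eq)
    ultimately show "\<exists>T. openin (seminorm_topology X P) T \<and> x \<in> T \<and> T \<subseteq> {x \<in> X. g x \<in> U}"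
      by blast
  qed
  then show ?thesis by (simp add: continuous_map_def top)
qed

text \<open>Take the two square summable sequences that vanish beyond their first terms \<open>x\<close> and \<open>y\<close>.\<close>
lemma vector_functional_sigma_weak_seminorm:
  "(\<lambda>T. cmod (cinner (blinfun_apply T x) y)) \<in>
    {\<lambda>T. cmod (\<Sum>n. cinner (blinfun_apply T (\<xi> n)) (\<zeta> n)) | \<xi> \<zeta> :: nat \<Rightarrow> 'a::complex_hilbert_space.
        summable (\<lambda>n. (norm (\<xi> n))\<^sup>2) \<and> summable (\<lambda>n. (norm (\<zeta> n))\<^sup>2)}"
proof -
  define \<xi> where "\<xi> n = (if n = 0 then x else 0)" for n :: nat
  define \<zeta> where "\<zeta> n = (if n = 0 then y else 0)" for n :: nat
  have "summable (\<lambda>n. (norm (\<xi> n))\<^sup>2)" "summable (\<lambda>n. (norm (\<zeta> n))\<^sup>2)"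
    by (rule summable_finite[of "{0}"]; simp add: \<xi>_def \<zeta>_def)+
  moreover have "(\<Sum>n. cinner (blinfun_apply T (\<xi> n)) (\<zeta> n)) = cinner (blinfun_apply T x) y" for T
    by (subst suminf_finite[of "{0}"]) (simp_all add: \<xi>_def \<zeta>_def)
  then have "(\<lambda>T. cmod (cinner (blinfun_apply T x) y)) =
      (\<lambda>T. cmod (\<Sum>n. cinner (blinfun_apply T (\<xi> n)) (\<zeta> n)))"
    by simp
  ultimately show ?thesis by blast
qed

lemma continuous_vector_functional:
  "continuous_map sigma_weak euclidean (\<lambda>T. cinner (blinfun_apply T x) y)"
  unfolding sigma_weak_def
  by (rule continuous_map_seminorm_topology[OF vector_functional_sigma_weak_seminorm])
    (simp add: blinfun.diff_left cinner_diff_left)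

lemma vector_state_in_predual_pos: "(\<lambda>d. cinner (blinfun_apply d x) x) \<in> predual_pos D"
  by (auto simp: predual_pos_def clinear_on_def blinfun.add_left cinner_add_left scale_op_apply
      cinner_scaleC_left pos_part_def positive_op_def
      intro: continuous_map_from_subtopology continuous_vector_functional)

section \<open>Conditional expectations onto a MASA\<close>

lemma star_subalgebraD:
  assumes "star_subalgebra A"
  shows "S \<in> A \<Longrightarrow> S \<in> bounded_ops"
    and "S \<in> A \<Longrightarrow> T \<in> A \<Longrightarrow> S o\<^sub>L T \<in> A"
    and "S \<in> A \<Longrightarrow> T \<in> A \<Longrightarrow> S + T \<in> A"
    and "S \<in> A \<Longrightarrow> T \<in> A \<Longrightarrow> S - T \<in> A"
    and "S \<in> A \<Longrightarrow> scale_op c S \<in> A"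
    and "S \<in> A \<Longrightarrow> r *\<^sub>R S \<in> A"
    and "S \<in> A \<Longrightarrow> op_adj S \<in> A"
    and "0 \<in> A"
  using assms
  by (auto simp: star_subalgebra_def scaleR_eq_scale_op
      intro: op.subspace_add op.subspace_diff op.subspace_scale op.subspace_0)

lemma compose_scale_op_left: "scale_op c S o\<^sub>L T = scale_op c (S o\<^sub>L T)"
  by (rule blinfun_eqI) (simp add: scale_op_apply)

lemma compose_scale_op_right: "S \<in> bounded_ops \<Longrightarrow> S o\<^sub>L scale_op c T = scale_op c (S o\<^sub>L T)"
  by (rule blinfun_eqI) (simp add: scale_op_apply bounded_opsD)

lemma compose_assoc: "(S o\<^sub>L T) o\<^sub>L U = S o\<^sub>L (T o\<^sub>L U)"
  by (rule blinfun_eqI) simp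

lemma compose_id [simp]: "id_blinfun o\<^sub>L T = T" "T o\<^sub>L id_blinfun = T"
  by (rule blinfun_eqI, simp)+

lemmas compose_distribs =
  bounded_bilinear.add_left[OF bounded_bilinear_blinfun_compose]
  bounded_bilinear.add_right[OF bounded_bilinear_blinfun_compose]
  bounded_bilinear.diff_left[OF bounded_bilinear_blinfun_compose]
  bounded_bilinear.diff_right[OF bounded_bilinear_blinfun_compose]

lemma cinner_adj_compose_self:
  "T \<in> bounded_ops \<Longrightarrow> cinner ((op_adj T o\<^sub>L T) x) x = complex_of_real ((norm (T x))\<^sup>2)"
  by (simp add: op_adj_left cinner_self)

text \<open>Adjoining the scalars to \<open>D\<close> gives an abelian star subalgebra again, so maximality applies.\<close>
lemma masa_contains_id:
  assumes "masa M D" and "star_subalgebra M" and "id_blinfun \<in> M"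
  shows "id_blinfun \<in> D"
proof -
  have D: "star_subalgebra D" and comm: "\<And>S T. S \<in> D \<Longrightarrow> T \<in> D \<Longrightarrow> S o\<^sub>L T = T o\<^sub>L S"
    and DM: "D \<subseteq> M"
    and max: "\<And>B. abelian_star_subalgebra B \<Longrightarrow> D \<subseteq> B \<Longrightarrow> B \<subseteq> M \<Longrightarrow> B = D"
    using assms(1) unfolding masa_def abelian_star_subalgebra_def by blast+
  note d = star_subalgebraD[OF D]
  define B where "B = {a + scale_op c id_blinfun | a c. a \<in> D}"
  have BI: "a + scale_op c id_blinfun \<in> B" if "a \<in> D" for a c using that B_def by blast
  have "star_subalgebra B"
    unfolding star_subalgebra_def op.subspace_def
  proof (intro conjI ballI allI subsetI)
    show "T \<in> bounded_ops" if "T \<in> B" for T using that d(1) by (auto simp: B_def)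
    show "0 \<in> B" using BI[OF d(8), of 0] by simp
    show "S + T \<in> B" if "S \<in> B" "T \<in> B" for S T
    proof -
      from that obtain a b c e where "a \<in> D" "b \<in> D"
        "S = a + scale_op c id_blinfun" "T = b + scale_op e id_blinfun" by (auto simp: B_def)
      then show ?thesis using BI[OF d(3)[of a b], of "c + e"] by (simp add: op.scale_left_distrib algebra_simps)
    qed
    show "scale_op e S \<in> B" if "S \<in> B" for S e
    proof -
      from that obtain a c where "a \<in> D" "S = a + scale_op c id_blinfun" by (auto simp: B_def)
      then show ?thesis using BI[OF d(5)[of a e], of "e * c"] by (simp add: op.scale_right_distrib)
    qed
    show "S o\<^sub>L T \<in> B" if "S \<in> B" "T \<in> B" for S T
    proof -
      from that obtain a b c e where ab: "a \<in> D" "b \<in> D"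
        "S = a + scale_op c id_blinfun" "T = b + scale_op e id_blinfun" by (auto simp: B_def)
      have "(a o\<^sub>L b) + scale_op e a + scale_op c b \<in> D" using ab d by auto
      note BI[OF this, of "c * e"]
      moreover have "S o\<^sub>L T =
          (a o\<^sub>L b) + scale_op e a + scale_op c b + scale_op (c * e) id_blinfun"
        using ab d(1) by (simp add: compose_distribs compose_scale_op_left
            compose_scale_op_right op.scale_right_distrib algebra_simps)
      ultimately show ?thesis by simp
    qed
    show "op_adj S \<in> B" if "S \<in> B" for S
    proof -
      from that obtain a c where "a \<in> D" "S = a + scale_op c id_blinfun" by (auto simp: B_def)
      then show ?thesis using BI[OF d(7)[of a], of "cnj c"] d(1) by (simp add: op_adj_algebra op_adj_scale)
    qed
  qed
  moreover have "S o\<^sub>L T = T o\<^sub>L S" if "S \<in> B" "T \<in> B" for S T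
  proof -
    from that obtain a b c e where "a \<in> D" "b \<in> D"
      "S = a + scale_op c id_blinfun" "T = b + scale_op e id_blinfun" by (auto simp: B_def)
    then show ?thesis using comm[of a b] d(1)
      by (simp add: compose_distribs compose_scale_op_left compose_scale_op_right
          op.scale_right_distrib algebra_simps)
  qed
  ultimately have "abelian_star_subalgebra B" by (simp add: abelian_star_subalgebra_def)
  moreover have "D \<subseteq> B"
  proof
    show "a \<in> B" if "a \<in> D" for a using BI[OF that, of 0] by simp
  qed
  moreover have "B \<subseteq> M"
    using DM star_subalgebraD[OF assms(2)] assms(3) by (auto simp: B_def)
  ultimately have "B = D" by (rule max)
  moreover have "id_blinfun \<in> B" using BI[OF d(8), of 1] by simp
  ultimately show ?thesis by simp
qed

locale masa_expectation =
  fixes M D :: "('h::complex_hilbert_space \<Rightarrow>\<^sub>L 'h) set"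
    and E :: "('h \<Rightarrow>\<^sub>L 'h) \<Rightarrow> ('h \<Rightarrow>\<^sub>L 'h)"
  assumes von_neumann: "von_neumann_algebra M"
    and masa: "masa M D"
    and expectation: "faithful_normal_conditional_expectation M D E"
begin

lemma M_star: "star_subalgebra M"
  using von_neumann by (simp add: von_neumann_algebra_def)

lemma D_star: "star_subalgebra D"
  using masa by (simp add: masa_def abelian_star_subalgebra_def)

lemmas M = star_subalgebraD[OF M_star]
lemmas D = star_subalgebraD[OF D_star]

lemma D_in_M: "d \<in> D \<Longrightarrow> d \<in> M"
  using masa by (auto simp: masa_def)

lemma D_commute: "c \<in> D \<Longrightarrow> d \<in> D \<Longrightarrow> c o\<^sub>L d = d o\<^sub>L c"
  using masa by (simp add: masa_def abelian_star_subalgebra_def)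

lemma id_in_M: "id_blinfun \<in> M"
proof -
  have "id_blinfun \<in> commutant (commutant M)" by (simp add: commutant_def)
  then show ?thesis using von_neumann by (simp add: von_neumann_algebra_def)
qed

lemma id_in_D: "id_blinfun \<in> D"
  using masa_contains_id[OF masa M_star id_in_M] .

lemma
  E_in_D: "x \<in> M \<Longrightarrow> E x \<in> D"
  and E_add: "x \<in> M \<Longrightarrow> y \<in> M \<Longrightarrow> E (x + y) = E x + E y"
  and E_scale: "x \<in> M \<Longrightarrow> E (scale_op a x) = scale_op a (E x)"
  and E_D: "d \<in> D \<Longrightarrow> E d = d"
  and E_positive: "x \<in> M \<Longrightarrow> positive_op x \<Longrightarrow> positive_op (E x)"
  and E_bimodule: "c \<in> D \<Longrightarrow> d \<in> D \<Longrightarrow> x \<in> M \<Longrightarrow> E (c o\<^sub>L x o\<^sub>L d) = c o\<^sub>L E x o\<^sub>L d"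
  and E_faithful: "x \<in> M \<Longrightarrow> positive_op x \<Longrightarrow> E x = 0 \<Longrightarrow> x = 0"
  and E_normal: "continuous_map (subtopology sigma_weak M) (subtopology sigma_weak D) E"
  using expectation
  by (auto simp: faithful_normal_conditional_expectation_def conditional_expectation_def
      clinear_on_def)

lemma E_bounded [simp]: "x \<in> M \<Longrightarrow> E x \<in> bounded_ops"
  using E_in_D D(1) by blast

lemma E_diff: "x \<in> M \<Longrightarrow> y \<in> M \<Longrightarrow> E (x - y) = E x - E y"
  using E_add[of "x - y" y] M(4)[of x y] by (simp add: algebra_simps)

lemma E_left: "c \<in> D \<Longrightarrow> x \<in> M \<Longrightarrow> E (c o\<^sub>L x) = c o\<^sub>L E x"
  using E_bimodule[of c id_blinfun x] id_in_D by simp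

text \<open>Adding the scalar \<open>\<parallel>x\<parallel>\<close>, which \<open>E\<close> fixes, makes \<open>x\<close> positive.\<close>
lemma E_selfadjoint:
  assumes x: "x \<in> M" and sa: "op_adj x = x"
  shows "op_adj (E x) = E x"
proof -
  let ?s = "scale_op (complex_of_real (norm x)) id_blinfun"
  have s: "?s \<in> D" using D(5)[OF id_in_D] .
  have "positive_op (x + ?s)"
    unfolding positive_op_iff
  proof (intro conjI allI)
    show "x + ?s \<in> bounded_ops" using M(1)[OF x] by simp
    fix z
    have "- inner (x z) z \<le> norm (x z) * norm z"
      using norm_cauchy_schwarz[of "- x z" z] by simp
    also have "\<dots> \<le> (norm x * norm z) * norm z"
      by (intro mult_right_mono norm_blinfun) simp
    finally show "0 \<le> Re (cinner ((x + ?s) z) z)"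
      by (simp add: blinfun.add_left scale_op_apply cinner_add_left cinner_scaleC_left cinner_self
          inner_eq_Re_cinner[symmetric] power2_eq_square mult.assoc)
    show "Im (cinner ((x + ?s) z) z) = 0"
      using selfadjoint_cinner_real[OF M(1)[OF x] sa, of z]
      by (simp add: blinfun.add_left scale_op_apply cinner_add_left cinner_scaleC_left cinner_self)
  qed
  then have "positive_op (E (x + ?s))" using x M(3) D_in_M[OF s] by (intro E_positive)
  then have "positive_op (E x + ?s)" by (simp add: E_add x D_in_M[OF s] E_D[OF s])
  from positive_op_selfadjoint[OF this] show ?thesis
    using x D(1)[OF s] by (simp add: op_adj_algebra op_adj_scale)
qed

text \<open>The self-adjoint elements \<open>x + x\<^sup>*\<close> and \<open>\<i> (x - x\<^sup>*)\<close> have self-adjoint expectations, and these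
  determine the expectations of \<open>x\<close> and \<open>x\<^sup>*\<close>.\<close>
lemma E_adj:
  assumes x: "x \<in> M"
  shows "E (op_adj x) = op_adj (E x)"
proof -
  have xs: "op_adj x \<in> M" using M(7)[OF x] .
  have xb: "x \<in> bounded_ops" using M(1)[OF x] .
  have re: "op_adj (E x) + op_adj (E (op_adj x)) = E x + E (op_adj x)"
    using E_selfadjoint[of "x + op_adj x"] x xs xb M(3)
    by (simp add: E_add op_adj_algebra op_adj_scale add.commute)
  have "op_adj (scale_op \<i> (x - op_adj x)) = scale_op \<i> (x - op_adj x)"
    using xb by (simp add: op_adj_algebra op_adj_scale op.scale_right_diff_distrib)
  from E_selfadjoint[OF _ this]
  have "scale_op (- \<i>) (op_adj (E x) - op_adj (E (op_adj x))) = scale_op \<i> (E x - E (op_adj x))"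
    using x xs xb M(4,5) by (simp add: E_scale E_diff op_adj_algebra op_adj_scale)
  then have "scale_op \<i> (op_adj (E (op_adj x)) - op_adj (E x)) = scale_op \<i> (E x - E (op_adj x))"
    by (simp add: op.scale_right_diff_distrib)
  then have im: "op_adj (E (op_adj x)) - op_adj (E x) = E x - E (op_adj x)"
    by (simp add: op.scale_left_imp_eq)
  have "2 *\<^sub>R op_adj (E x) =
      (op_adj (E x) + op_adj (E (op_adj x))) - (op_adj (E (op_adj x)) - op_adj (E x))"
    by (simp add: scaleR_2)
  also have "\<dots> = (E x + E (op_adj x)) - (E x - E (op_adj x))"
    by (simp only: re im)
  also have "\<dots> = 2 *\<^sub>R E (op_adj x)"
    by (simp add: scaleR_2)
  finally show ?thesis by simp
qed

lemma expectation_adj_compose_eq_0: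
  assumes "x \<in> M" and "E (op_adj x o\<^sub>L x) = 0"
  shows "x = 0"
  using adj_compose_eq_0[OF M(1)[OF assms(1)]] E_faithful assms M positive_adj_compose by metis

lemma bures_seminorm:
  "(\<lambda>T. sqrt (Re (cinner (blinfun_apply (E (op_adj T o\<^sub>L T)) \<xi>) \<xi>))) \<in>
    {\<lambda>T. sqrt (Re (\<tau> (E (op_adj T o\<^sub>L T)))) | \<tau>. \<tau> \<in> predual_pos D}"
  by (rule CollectI, rule exI[of _ "\<lambda>d. cinner (blinfun_apply d \<xi>) \<xi>"])
    (simp add: vector_state_in_predual_pos)

lemma topspace_bures: "topspace (bures_topology M D E) = M"
  unfolding bures_topology_def
  by (rule topspace_seminorm_topology[OF bures_seminorm[of 0]]) simp

text \<open>The functional \<open>x \<mapsto> \<langle>T (E x) \<xi>, \<zeta>\<rangle>\<close> is \<open>\<sigma>\<close>-weakly continuous on \<open>M\<close>, because \<open>E\<close> is normal, and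
  it vanishes on \<open>W\<close>; hence it vanishes at the identity, where its value is \<open>\<langle>T \<xi>, \<zeta>\<rangle>\<close>.\<close>
lemma eq_0_if_annihilates_expectation_of_dense:
  assumes W: "W \<subseteq> M" and dense: "M \<subseteq> sigma_weak closure_of W"
    and T: "T \<in> bounded_ops" and zero: "\<And>x. x \<in> W \<Longrightarrow> T o\<^sub>L E x = 0"
  shows "T = 0"
proof (rule blinfun_eqI, rule cinner_extensionality)
  fix \<xi> \<zeta>
  let ?g = "\<lambda>x. cinner (E x \<xi>) (op_adj T \<zeta>)"
  have g: "?g x = cinner ((T o\<^sub>L E x) \<xi>) \<zeta>" for x
    by (simp add: op_adj_right[OF T])
  have cont: "continuous_map (subtopology sigma_weak M) euclidean ?g"
    using continuous_map_compose[OF E_normal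
        continuous_map_from_subtopology[OF continuous_vector_functional[of \<xi> "op_adj T \<zeta>"]]]
    by (simp add: comp_def)
  have "id_blinfun \<in> (subtopology sigma_weak M) closure_of W"
    using id_in_M dense W by (auto simp: closure_of_subtopology_subset closure_of_subtopology Int_absorb1)
  then have "?g id_blinfun \<in> euclidean closure_of (?g ` W)"
    using continuous_map_image_closure_subset[OF cont, of W] by blast
  also have "\<dots> \<subseteq> euclidean closure_of {0}"
    by (rule closure_of_mono) (auto simp: g zero)
  finally have "cinner (T \<xi>) \<zeta> = 0" by (simp add: E_D[OF id_in_D] op_adj_right[OF T])
  then show "cinner \<zeta> (T \<xi>) = cinner \<zeta> (blinfun_apply 0 \<xi>)"
    using cinner_commute[of \<zeta> "T \<xi>"] by simp
qed

end

section \<open>The residual of a normalizer\<close>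

context masa_expectation
begin

text \<open>For a normalizer \<open>v\<close>, the map \<open>x \<mapsto> v E(v\<^sup>* x)\<close> is the projection of \<open>M\<close> onto the part supported on \<open>v\<close>, the algebraic
  form of the support projection \<open>P\<^sub>v\<close>. The residual is the complementary part of \<open>x\<close>.\<close>
definition residual :: "('h \<Rightarrow>\<^sub>L 'h) \<Rightarrow> ('h \<Rightarrow>\<^sub>L 'h) \<Rightarrow> ('h \<Rightarrow>\<^sub>L 'h)" where
  "residual v x = x - (v o\<^sub>L E (op_adj v o\<^sub>L x))"

lemma partial_isometry_absorb:
  assumes "partial_isometry v"
  shows "v o\<^sub>L op_adj v o\<^sub>L v = v"
proof (rule blinfun_eqI)
  fix x
  have v: "v \<in> bounded_ops" and p: "projection (op_adj v o\<^sub>L v)"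
    using assms by (auto simp: partial_isometry_def)
  let ?y = "op_adj v (v x) - x"
  have "(op_adj v o\<^sub>L v) ?y = 0"
    using projectionD(2)[OF p, of x] by (simp add: blinfun.diff_right)
  then have "complex_of_real ((norm (v ?y))\<^sup>2) = 0"
    using cinner_adj_compose_self[OF v, of ?y] by simp
  then show "(v o\<^sub>L op_adj v o\<^sub>L v) x = v x" by (simp add: blinfun.diff_right)
qed

lemma normalizerD:
  assumes "v \<in> groupoid_normalizer M D"
  shows "v \<in> M" and "v o\<^sub>L op_adj v o\<^sub>L v = v" and "op_adj v o\<^sub>L v o\<^sub>L op_adj v = op_adj v"
    and "c \<in> D \<Longrightarrow> op_adj v o\<^sub>L c o\<^sub>L v \<in> D"
    and "op_adj v o\<^sub>L v \<in> D" and "v o\<^sub>L op_adj v \<in> D"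
proof -
  show vM: "v \<in> M" and vv: "v o\<^sub>L op_adj v o\<^sub>L v = v"
    and conj: "c \<in> D \<Longrightarrow> op_adj v o\<^sub>L c o\<^sub>L v \<in> D" for c
    using assms by (auto simp: groupoid_normalizer_def partial_isometry_absorb)
  have vb: "v \<in> bounded_ops" using M(1)[OF vM] .
  have "op_adj (v o\<^sub>L op_adj v o\<^sub>L v) = op_adj v" by (simp add: vv)
  then show "op_adj v o\<^sub>L v o\<^sub>L op_adj v = op_adj v"
    using vb by (simp add: op_adj_algebra compose_assoc)
  show "op_adj v o\<^sub>L v \<in> D" using conj[OF id_in_D] by simp
  have "v o\<^sub>L id_blinfun o\<^sub>L op_adj v \<in> D"
    using assms id_in_D unfolding groupoid_normalizer_def by blast
  then show "v o\<^sub>L op_adj v \<in> D" by simp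
qed

context
  fixes v
  assumes v: "v \<in> groupoid_normalizer M D"
begin

lemma v_in_M: "v \<in> M" and v_adj_in_M: "op_adj v \<in> M"
  using normalizerD(1)[OF v] M(7) by blast+

lemma residual_in_M: "x \<in> M \<Longrightarrow> residual v x \<in> M"
  using M(4)[OF _ M(2)[OF v_in_M D_in_M[OF E_in_D[OF M(2)[OF v_adj_in_M]]]]]
  by (simp add: residual_def)

lemma residual_add: "x \<in> M \<Longrightarrow> y \<in> M \<Longrightarrow> residual v (x + y) = residual v x + residual v y"
  using M(2)[OF v_adj_in_M] by (simp add: residual_def compose_distribs E_add algebra_simps)

lemma residual_diff: "x \<in> M \<Longrightarrow> y \<in> M \<Longrightarrow> residual v (x - y) = residual v x - residual v y"
  using M(2)[OF v_adj_in_M] by (simp add: residual_def compose_distribs E_diff algebra_simps)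

lemma residual_scale: "x \<in> M \<Longrightarrow> residual v (scale_op c x) = scale_op c (residual v x)"
  using M(2)[OF v_adj_in_M] M(1)[OF v_in_M] M(1)[OF v_adj_in_M]
  by (simp add: residual_def compose_scale_op_right E_scale op.scale_right_diff_distrib)

lemma residual_self: "residual v v = 0"
  using normalizerD(2,5)[OF v] by (simp add: residual_def E_D compose_assoc)

text \<open>A normalizer intertwines \<open>c \<in> D\<close> with \<open>v\<^sup>* c v \<in> D\<close>: since \<open>c\<close> commutes with \<open>v v\<^sup>* \<in> D\<close>, one has
  \<open>c v = v (v\<^sup>* c v)\<close> and \<open>v\<^sup>* c = (v\<^sup>* c v) v\<^sup>*\<close>. So left multiplication by \<open>c\<close> passes through
  \<open>v E(v\<^sup>* \<cdot>)\<close>.\<close>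
lemma residual_bimodule:
  assumes c: "c \<in> D" and d: "d \<in> D" and x: "x \<in> M"
  shows "residual v (c o\<^sub>L x o\<^sub>L d) = c o\<^sub>L residual v x o\<^sub>L d"
proof -
  let ?c = "op_adj v o\<^sub>L c o\<^sub>L v"
  have vx: "op_adj v o\<^sub>L x \<in> M" using M(2)[OF v_adj_in_M x] .
  have comm: "c o\<^sub>L (v o\<^sub>L op_adj v) = (v o\<^sub>L op_adj v) o\<^sub>L c"
    by (rule D_commute[OF c normalizerD(6)[OF v]])
  have "c o\<^sub>L v = (c o\<^sub>L (v o\<^sub>L op_adj v)) o\<^sub>L v"
    using normalizerD(2)[OF v] by (simp add: compose_assoc)
  then have left: "c o\<^sub>L v = v o\<^sub>L ?c" unfolding comm by (simp add: compose_assoc)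
  have "op_adj v o\<^sub>L c = op_adj v o\<^sub>L ((v o\<^sub>L op_adj v) o\<^sub>L c)"
    using arg_cong[OF normalizerD(3)[OF v], of "\<lambda>t. t o\<^sub>L c"] by (simp add: compose_assoc)
  also have "\<dots> = op_adj v o\<^sub>L (c o\<^sub>L (v o\<^sub>L op_adj v))" by (simp only: comm)
  also have "\<dots> = ?c o\<^sub>L op_adj v" by (simp only: compose_assoc)
  finally have right: "op_adj v o\<^sub>L c = ?c o\<^sub>L op_adj v" .
  have "op_adj v o\<^sub>L (c o\<^sub>L x o\<^sub>L d) = ?c o\<^sub>L (op_adj v o\<^sub>L x) o\<^sub>L d"
    using arg_cong[OF right, of "\<lambda>t. t o\<^sub>L x o\<^sub>L d"] by (simp add: compose_assoc)
  then have "v o\<^sub>L E (op_adj v o\<^sub>L (c o\<^sub>L x o\<^sub>L d)) = v o\<^sub>L ?c o\<^sub>L E (op_adj v o\<^sub>L x) o\<^sub>L d"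
    using E_bimodule[OF normalizerD(4)[OF v c] d vx] by (simp add: compose_assoc)
  also have "\<dots> = c o\<^sub>L (v o\<^sub>L E (op_adj v o\<^sub>L x)) o\<^sub>L d"
    using arg_cong[OF left, of "\<lambda>t. t o\<^sub>L E (op_adj v o\<^sub>L x) o\<^sub>L d"] by (simp add: compose_assoc)
  finally show ?thesis by (simp add: residual_def compose_distribs)
qed

text \<open>The residual of \<open>x\<close> is orthogonal to \<open>v\<close> for the \<open>D\<close>-valued inner product \<open>E(y\<^sup>* x)\<close>.\<close>
lemma E_adj_residual:
  assumes x: "x \<in> M"
  shows "E (op_adj v o\<^sub>L residual v x) = 0"
proof -
  let ?e = "E (op_adj v o\<^sub>L x)"
  have vx: "op_adj v o\<^sub>L x \<in> M" using M(2)[OF v_adj_in_M x] .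
  have e: "(op_adj v o\<^sub>L v) o\<^sub>L ?e \<in> D" using D(2)[OF normalizerD(5)[OF v] E_in_D[OF vx]] .
  have "(op_adj v o\<^sub>L v) o\<^sub>L ?e = E ((op_adj v o\<^sub>L v) o\<^sub>L (op_adj v o\<^sub>L x))"
    by (rule E_left[OF normalizerD(5)[OF v] vx, symmetric])
  also have "(op_adj v o\<^sub>L v) o\<^sub>L (op_adj v o\<^sub>L x) = op_adj v o\<^sub>L x"
    using arg_cong[OF normalizerD(3)[OF v], of "\<lambda>t. t o\<^sub>L x"] by (simp add: compose_assoc)
  finally have "(op_adj v o\<^sub>L v) o\<^sub>L ?e = ?e" .
  moreover have "op_adj v o\<^sub>L residual v x = (op_adj v o\<^sub>L x) - ((op_adj v o\<^sub>L v) o\<^sub>L ?e)"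
    by (simp add: residual_def compose_distribs compose_assoc)
  ultimately show ?thesis using vx by (simp add: E_diff E_D E_in_D D_in_M)
qed

text \<open>Pythagoras for the \<open>D\<close>-valued inner product: in \<open>x = y + w\<close>, with \<open>y\<close> the residual and
  \<open>w = v E(v\<^sup>* x)\<close>, the mixed terms have expectation zero, so that
  \<open>E(x\<^sup>* x) = E(y\<^sup>* y) + E(w\<^sup>* w)\<close>.\<close>
lemma E_residual_le:
  assumes x: "x \<in> M"
  shows "op_le (E (op_adj (residual v x) o\<^sub>L residual v x)) (E (op_adj x o\<^sub>L x))"
proof -
  define e where "e = E (op_adj v o\<^sub>L x)"
  define y where "y = residual v x"
  define w where "w = v o\<^sub>L e"
  have eD: "e \<in> D" unfolding e_def using E_in_D M(2)[OF v_adj_in_M x] by blast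
  have yM: "y \<in> M" unfolding y_def using residual_in_M[OF x] .
  have wM: "w \<in> M" unfolding w_def using M(2)[OF v_in_M D_in_M[OF eD]] .
  note b = M(1)[OF yM] M(1)[OF wM] M(1)[OF v_in_M] D(1)[OF eD]
  have xyw: "x = y + w" by (simp add: y_def w_def e_def residual_def)
  have vy: "op_adj v o\<^sub>L y \<in> M" using M(2)[OF v_adj_in_M yM] .
  have Evy: "E (op_adj v o\<^sub>L y) = 0" unfolding y_def by (rule E_adj_residual[OF x])
  have wy: "E (op_adj w o\<^sub>L y) = 0"
    using E_left[OF D(7)[OF eD] vy] b by (simp add: w_def op_adj_algebra compose_assoc Evy)
  have wyM: "op_adj w o\<^sub>L y \<in> M" using M(2)[OF M(7)[OF wM] yM] .
  have "op_adj y o\<^sub>L w = op_adj (op_adj w o\<^sub>L y)" using b by (simp add: op_adj_algebra)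
  then have yw: "E (op_adj y o\<^sub>L w) = 0"
    using E_adj[OF wyM] wy by simp
  have "op_adj x o\<^sub>L x = (op_adj y o\<^sub>L y) + (op_adj y o\<^sub>L w) + (op_adj w o\<^sub>L y) + (op_adj w o\<^sub>L w)"
    using b by (simp add: xyw op_adj_algebra compose_distribs algebra_simps)
  then have "E (op_adj x o\<^sub>L x) - E (op_adj y o\<^sub>L y) = E (op_adj w o\<^sub>L w)"
    using yM wM M(2,3,7) by (simp add: E_add wy yw)
  moreover have "positive_op (E (op_adj w o\<^sub>L w))"
    using wM b M(2,7) by (intro E_positive positive_adj_compose) auto
  ultimately show ?thesis by (simp add: op_le_def y_def)
qed

lemma residual_kernel_bimodule: "bimodule M D {x \<in> M. residual v x = 0}"
  unfolding bimodule_def op.subspace_def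
  using M residual_self
  by (auto simp: residual_add residual_scale residual_bimodule D_in_M residual_diff[of 0 0, simplified])

text \<open>Taking residuals increases no seminorm \<open>T \<mapsto> \<tau>(E(T\<^sup>* T))\<^sup>1\<^sup>/\<^sup>2\<close> of the Bures topology. If the residual of \<open>x\<close> is not
  zero, faithfulness of \<open>E\<close> gives a vector functional whose seminorm \<open>p\<close> is positive on it, and every
  \<open>y\<close> with zero residual satisfies \<open>p (y - x) \<ge> p (residual v x)\<close>.\<close>
lemma residual_kernel_closed: "closedin (bures_topology M D E) {x \<in> M. residual v x = 0}"
  unfolding closedin_def topspace_bures
proof (intro conjI)
  show "openin (bures_topology M D E) (M - {x \<in> M. residual v x = 0})"
  proof (subst openin_subopen, intro ballI)
    fix x assume "x \<in> M - {x \<in> M. residual v x = 0}"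
    then have x: "x \<in> M" "residual v x \<noteq> 0" by auto
    let ?G = "\<lambda>y. op_adj y o\<^sub>L y"
    have rM: "residual v x \<in> M" using residual_in_M[OF x(1)] .
    have GM: "?G y \<in> M" if "y \<in> M" for y using that M(2,7) by blast
    have pos: "positive_op (E (?G y))" if "y \<in> M" for y
      using that GM M(1) by (intro E_positive positive_adj_compose) auto
    have "E (?G (residual v x)) \<noteq> 0"
      using expectation_adj_compose_eq_0[OF rM] x(2) by blast
    moreover have "E (?G (residual v x)) = 0"
      if "\<And>\<xi>. Re (cinner (E (?G (residual v x)) \<xi>) \<xi>) = 0"
      using positive_cauchy_schwarz[OF pos[OF rM]] that by (intro blinfun_eqI) simp
    ultimately obtain \<xi> where \<xi>: "Re (cinner (E (?G (residual v x)) \<xi>) \<xi>) \<noteq> 0" by blast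
    define p where "p T = sqrt (Re (cinner (E (?G T) \<xi>) \<xi>))" for T
    have "0 \<le> Re (cinner (E (?G (residual v x)) \<xi>) \<xi>)"
      using pos[OF rM] by (simp add: positive_op_iff)
    then have p0: "0 < p (residual v x)" using \<xi> by (simp add: p_def)
    have p_le: "p (residual v y) \<le> p y" if "y \<in> M" for y
      using E_residual_le[OF that]
      by (auto simp: p_def op_le_def positive_op_iff blinfun.diff_left cinner_diff_left)
    have p_minus: "p (- y) = p y" if "y \<in> M" for y
    proof -
      have "op_adj (- y) = - op_adj y"
        using op_adj_algebra(3)[of 0 y] M(1)[OF that] by simp
      then have "?G (- y) = ?G y" by (intro blinfun_eqI) (simp add: blinfun.minus_left blinfun.minus_right)
      then show ?thesis by (simp add: p_def)
    qed
    let ?B = "{y \<in> M. p (y - x) < p (residual v x)}"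
    have "openin (bures_topology M D E) ?B"
      unfolding bures_topology_def p_def
      by (rule openin_seminorm_ball[OF bures_seminorm x(1)]) (use p0 p_def in simp)
    moreover have "x \<in> ?B"
    proof -
      have "p (x - x) = 0" by (simp add: p_def E_D[OF D(8)])
      then show ?thesis using x(1) p0 by simp
    qed
    moreover have "?B \<subseteq> M - {x \<in> M. residual v x = 0}"
    proof (safe, simp_all)
      fix y assume y: "y \<in> M" "p (y - x) < p (residual v x)" "residual v y = 0"
      then have "residual v (y - x) = - residual v x" by (simp add: residual_diff x(1))
      then show False using p_le[of "y - x"] y x(1) M(4) p_minus[OF rM] by simp
    qed
    ultimately show "\<exists>T. openin (bures_topology M D E) T \<and> x \<in> T \<and>
        T \<subseteq> M - {x \<in> M. residual v x = 0}" by blast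
  qed
qed auto

lemma generated_bimodule_residual:
  assumes "x \<in> bures_closed_bimodule_generated M D E v"
  shows "x \<in> M" and "residual v x = 0"
  using assms residual_kernel_bimodule residual_kernel_closed residual_self v_in_M
  unfolding bures_closed_bimodule_generated_def by blast+

text \<open>If \<open>u = v d\<close>, the residual of \<open>u\<close> is the residual of \<open>v\<close> times \<open>d\<close>; and \<open>v\<close> has residual zero.\<close>
lemma normalizer_le_iff_residual:
  assumes "u \<in> M"
  shows "normalizer_le D u v \<longleftrightarrow> residual v u = 0"
proof
  assume "normalizer_le D u v"
  then obtain d where d: "d \<in> D" "u = id_blinfun o\<^sub>L v o\<^sub>L d" by (auto simp: normalizer_le_def)
  then show "residual v u = 0"
    using residual_bimodule[OF id_in_D d(1) v_in_M] by (simp add: residual_self)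
next
  assume "residual v u = 0"
  then have "u = v o\<^sub>L E (op_adj v o\<^sub>L u)" by (simp add: residual_def)
  then show "normalizer_le D u v"
    unfolding normalizer_le_def using E_in_D M(2)[OF v_adj_in_M assms] by blast
qed

end

lemma generated_bimodule_mono:
  assumes "d \<in> D"
  shows "bures_closed_bimodule_generated M D E (v o\<^sub>L d) \<subseteq> bures_closed_bimodule_generated M D E v"
proof -
  have "v o\<^sub>L d \<in> S" if "bimodule M D S" "v \<in> S" for S
  proof -
    have "id_blinfun o\<^sub>L v o\<^sub>L d \<in> S" using that id_in_D assms unfolding bimodule_def by blast
    then show ?thesis by simp
  qed
  then show ?thesis unfolding bures_closed_bimodule_generated_def by blast
qed

lemma generated_bimodule_self: "v \<in> bures_closed_bimodule_generated M D E v"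
  unfolding bures_closed_bimodule_generated_def by blast

end

section \<open>The semi-cyclic representation\<close>

locale masa_expectation_gns = masa_expectation M D E
  for M D :: "('h::complex_hilbert_space \<Rightarrow>\<^sub>L 'h) set"
    and E :: "('h \<Rightarrow>\<^sub>L 'h) \<Rightarrow> ('h \<Rightarrow>\<^sub>L 'h)" +
  fixes \<phi> :: "('h \<Rightarrow>\<^sub>L 'h) \<Rightarrow> ennreal"
    and \<pi> :: "('h \<Rightarrow>\<^sub>L 'h) \<Rightarrow> ('k::complex_hilbert_space \<Rightarrow>\<^sub>L 'k)"
    and \<eta> :: "('h \<Rightarrow>\<^sub>L 'h) \<Rightarrow> 'k"
  assumes phi: "fns_weight M \<phi>"
    and phi_E: "\<And>x. x \<in> pos_part M \<Longrightarrow> \<phi> (E x) = \<phi> x"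
    and gns: "semicyclic_representation M \<phi> \<pi> \<eta>"
begin

abbreviation "N \<equiv> left_ideal_of_weight M \<phi>"

lemma phi_add: "x \<in> pos_part M \<Longrightarrow> y \<in> pos_part M \<Longrightarrow> \<phi> (x + y) = \<phi> x + \<phi> y"
  and phi_scale: "0 \<le> r \<Longrightarrow> x \<in> pos_part M \<Longrightarrow> \<phi> (r *\<^sub>R x) = ennreal r * \<phi> x"
  and phi_faithful: "x \<in> pos_part M \<Longrightarrow> \<phi> x = 0 \<Longrightarrow> x = 0"
  and phi_semifinite: "M \<subseteq> sigma_weak closure_of (weight_domain M \<phi>)"
  using phi by (auto simp: fns_weight_def weight_def faithful_weight_def semifinite_weight_def)

lemma phi_mono:
  assumes "x \<in> pos_part M" and "y \<in> pos_part M" and "op_le x y"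
  shows "\<phi> x \<le> \<phi> y"
proof -
  have "y - x \<in> pos_part M" using assms M(4) by (auto simp: pos_part_def op_le_def)
  from phi_add[OF assms(1) this] show ?thesis by simp
qed

lemma adj_compose_pos_part: "x \<in> M \<Longrightarrow> op_adj x o\<^sub>L x \<in> pos_part M"
  unfolding pos_part_def using positive_adj_compose[OF M(1)] M(2)[OF M(7)] by blast

lemma pos_part_scale: "0 \<le> r \<Longrightarrow> x \<in> pos_part M \<Longrightarrow> r *\<^sub>R x \<in> pos_part M"
  using M(6) by (auto simp: pos_part_def positive_op_iff blinfun.scaleR_left scaleR_scaleC cinner_scaleC_left)

lemma pos_part_add: "x \<in> pos_part M \<Longrightarrow> y \<in> pos_part M \<Longrightarrow> x + y \<in> pos_part M"
  using M(3) by (auto simp: pos_part_def positive_op_iff blinfun.add_left cinner_add_left)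

lemma pos_part_E: "x \<in> pos_part M \<Longrightarrow> E x \<in> pos_part M"
  using E_positive E_in_D D_in_M by (auto simp: pos_part_def)

lemma pos_part_op_leI:
  assumes "x \<in> pos_part M" and "y \<in> pos_part M"
    and "\<And>z. Re (cinner (x z) z) \<le> Re (cinner (y z) z)"
  shows "op_le x y"
  using assms positive_op_selfadjoint by (intro op_leI) (auto simp: pos_part_def positive_op_iff)

lemma N_in_M: "x \<in> N \<Longrightarrow> x \<in> M"
  by (simp add: left_ideal_of_weight_def)

text \<open>This rests on \<open>(a x)\<^sup>* (a x) \<le> \<parallel>a\<parallel>\<^sup>2 x\<^sup>* x\<close>.\<close>
lemma N_left:
  assumes a: "a \<in> M" and x: "x \<in> N"
  shows "a o\<^sub>L x \<in> N"
proof -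
  have xM: "x \<in> M" and fin: "\<phi> (op_adj x o\<^sub>L x) < \<infinity>" using x by (auto simp: left_ideal_of_weight_def)
  have axM: "a o\<^sub>L x \<in> M" using M(2)[OF a xM] .
  have "\<phi> (op_adj (a o\<^sub>L x) o\<^sub>L (a o\<^sub>L x)) \<le> \<phi> ((norm a)\<^sup>2 *\<^sub>R (op_adj x o\<^sub>L x))"
  proof (intro phi_mono pos_part_op_leI adj_compose_pos_part pos_part_scale axM xM)
    fix z
    have "(norm (a (x z)))\<^sup>2 \<le> (norm a * norm (x z))\<^sup>2" by (intro power_mono norm_blinfun) simp
    then show "Re (cinner ((op_adj (a o\<^sub>L x) o\<^sub>L (a o\<^sub>L x)) z) z)
        \<le> Re (cinner (((norm a)\<^sup>2 *\<^sub>R (op_adj x o\<^sub>L x)) z) z)"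
      unfolding cinner_adj_compose_self[OF M(1)[OF axM]] blinfun.scaleR_left scaleR_scaleC
        cinner_scaleC_left cinner_adj_compose_self[OF M(1)[OF xM]]
      by (simp add: power_mult_distrib)
  qed simp_all
  also have "\<dots> = ennreal ((norm a)\<^sup>2) * \<phi> (op_adj x o\<^sub>L x)"
    by (intro phi_scale adj_compose_pos_part xM) simp
  also have "\<dots> < \<infinity>" using fin by (simp add: ennreal_mult_less_top)
  finally show ?thesis using axM by (simp add: left_ideal_of_weight_def)
qed

lemma N_scale: "x \<in> N \<Longrightarrow> scale_op c x \<in> N"
  using N_left[OF M(5)[OF id_in_M], of x c] by (simp add: compose_scale_op_left)

text \<open>This rests on \<open>(x + y)\<^sup>* (x + y) \<le> 2 (x\<^sup>* x + y\<^sup>* y)\<close>.\<close>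
lemma N_add:
  assumes x: "x \<in> N" and y: "y \<in> N"
  shows "x + y \<in> N"
proof -
  have xM: "x \<in> M" "y \<in> M" and fin: "\<phi> (op_adj x o\<^sub>L x) < \<infinity>" "\<phi> (op_adj y o\<^sub>L y) < \<infinity>"
    using x y by (auto simp: left_ideal_of_weight_def)
  let ?s = "(op_adj x o\<^sub>L x) + (op_adj y o\<^sub>L y)"
  have xyM: "x + y \<in> M" using M(3)[OF xM] .
  have s: "?s \<in> pos_part M" by (intro pos_part_add adj_compose_pos_part xM)
  have "\<phi> (op_adj (x + y) o\<^sub>L (x + y)) \<le> \<phi> (2 *\<^sub>R ?s)"
  proof (intro phi_mono pos_part_op_leI pos_part_scale s adj_compose_pos_part xyM)
    fix z
    have "0 \<le> (norm (x z - y z))\<^sup>2" by simp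
    then have "(norm (x z + y z))\<^sup>2 \<le> 2 * ((norm (x z))\<^sup>2 + (norm (y z))\<^sup>2)"
      unfolding power2_norm_eq_inner by (simp add: inner_diff_left inner_diff_right
          inner_add_left inner_add_right inner_commute)
    then show "Re (cinner ((op_adj (x + y) o\<^sub>L (x + y)) z) z) \<le> Re (cinner ((2 *\<^sub>R ?s) z) z)"
      unfolding cinner_adj_compose_self[OF M(1)[OF xyM]] blinfun.scaleR_left blinfun.add_left
        scaleR_scaleC cinner_scaleC_left cinner_add_left
        cinner_adj_compose_self[OF M(1)[OF xM(1)]] cinner_adj_compose_self[OF M(1)[OF xM(2)]]
      by simp
  qed simp_all
  also have "\<dots> = ennreal 2 * (\<phi> (op_adj x o\<^sub>L x) + \<phi> (op_adj y o\<^sub>L y))"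
    using phi_scale[OF _ s, of 2] by (simp add: phi_add adj_compose_pos_part xM)
  also have "\<dots> < \<infinity>" using fin by (simp add: ennreal_mult_less_top)
  finally show ?thesis using xyM by (simp add: left_ideal_of_weight_def)
qed

lemma N_diff: "x \<in> N \<Longrightarrow> y \<in> N \<Longrightarrow> x - y \<in> N"
  using N_add[of x "scale_op (-1) y"] N_scale[of y "-1"] by simp

lemma eta_add: "x \<in> N \<Longrightarrow> y \<in> N \<Longrightarrow> \<eta> (x + y) = \<eta> x + \<eta> y"
  and eta_scale: "x \<in> N \<Longrightarrow> \<eta> (scale_op c x) = c *\<^sub>C \<eta> x"
  and pi_eta: "a \<in> M \<Longrightarrow> x \<in> N \<Longrightarrow> \<pi> a (\<eta> x) = \<eta> (a o\<^sub>L x)"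
  using gns by (auto simp: semicyclic_representation_def clinear_on_def)

lemma eta_diff: "x \<in> N \<Longrightarrow> y \<in> N \<Longrightarrow> \<eta> (x - y) = \<eta> x - \<eta> y"
  using eta_add[of "x - y" y] N_diff[of x y] by (simp add: algebra_simps)

lemma norm_eta:
  assumes x: "x \<in> N"
  shows "(norm (\<eta> x))\<^sup>2 = enn2real (\<phi> (op_adj x o\<^sub>L x))"
proof -
  obtain f where f: "linear_extension M \<phi> f" "cinner (\<eta> x) (\<eta> x) = f (op_adj x o\<^sub>L x)"
    using gns x unfolding semicyclic_representation_def by blast
  have "f (op_adj x o\<^sub>L x) = complex_of_real (enn2real (\<phi> (op_adj x o\<^sub>L x)))"
    using f(1) x adj_compose_pos_part[OF N_in_M[OF x]]
    by (simp add: linear_extension_def left_ideal_of_weight_def)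
  with f(2) show ?thesis by (simp add: cinner_self del: of_real_power)
qed

lemma eta_eq_0:
  assumes x: "x \<in> N" and "\<eta> x = 0"
  shows "x = 0"
proof -
  have "enn2real (\<phi> (op_adj x o\<^sub>L x)) = 0" using norm_eta[OF x] assms(2) by simp
  then have "\<phi> (op_adj x o\<^sub>L x) = 0"
    using x by (auto simp: enn2real_eq_0_iff left_ideal_of_weight_def)
  then have "op_adj x o\<^sub>L x = 0" using phi_faithful adj_compose_pos_part[OF N_in_M[OF x]] by blast
  then show ?thesis using adj_compose_eq_0[OF M(1)[OF N_in_M[OF x]]] by blast
qed

text \<open>On the Hilbert space of the representation, the residual becomes the projection complementary to
  the support of \<open>v\<close>. Contractivity comes from the inequality of the expectations and the
  invariance of the weight under \<open>E\<close>.\<close>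
lemma residual_eta_contractive:
  assumes v: "v \<in> groupoid_normalizer M D" and x: "x \<in> N"
  shows "residual v x \<in> N" and "norm (\<eta> (residual v x)) \<le> norm (\<eta> x)"
proof -
  let ?r = "residual v x"
  have xM: "x \<in> M" using N_in_M[OF x] .
  have rM: "?r \<in> M" using residual_in_M[OF v xM] .
  note p = adj_compose_pos_part[OF xM] adj_compose_pos_part[OF rM]
  have le: "\<phi> (op_adj ?r o\<^sub>L ?r) \<le> \<phi> (op_adj x o\<^sub>L x)"
    using phi_mono[OF pos_part_E[OF p(2)] pos_part_E[OF p(1)] E_residual_le[OF v xM]]
    by (simp add: phi_E p)
  moreover have fin: "\<phi> (op_adj x o\<^sub>L x) < \<infinity>" using x by (simp add: left_ideal_of_weight_def)
  ultimately show rN: "?r \<in> N" using rM by (auto simp: left_ideal_of_weight_def intro: le_less_trans)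
  have "(norm (\<eta> ?r))\<^sup>2 \<le> (norm (\<eta> x))\<^sup>2"
    unfolding norm_eta[OF rN] norm_eta[OF x] using le fin by (intro enn2real_mono) auto
  then show "norm (\<eta> ?r) \<le> norm (\<eta> x)" by (rule power2_le_imp_le) simp
qed

text \<open>For \<open>a = E x\<close> one has \<open>a\<^sup>2 \<le> \<parallel>a\<parallel> a\<close>, and \<open>\<phi> a = \<phi> x\<close> is finite.\<close>
lemma E_finite_in_N:
  assumes x: "x \<in> pos_part M" and fin: "\<phi> x < \<infinity>"
  shows "E x \<in> N"
proof -
  let ?a = "E x"
  have a: "?a \<in> pos_part M" "positive_op ?a" "?a \<in> M"
    using pos_part_E[OF x] by (auto simp: pos_part_def)
  have "\<phi> (op_adj ?a o\<^sub>L ?a) \<le> \<phi> (norm ?a *\<^sub>R ?a)"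
  proof (intro phi_mono pos_part_op_leI pos_part_scale adj_compose_pos_part a)
    show "Re (cinner ((op_adj ?a o\<^sub>L ?a) z) z) \<le> Re (cinner ((norm ?a *\<^sub>R ?a) z) z)" for z
      unfolding cinner_adj_compose_self[OF M(1)[OF a(3)]] blinfun.scaleR_left
        scaleR_scaleC cinner_scaleC_left
      using positive_cauchy_schwarz[OF a(2), of z] by simp
  qed simp_all
  also have "\<dots> = ennreal (norm ?a) * \<phi> x" using phi_scale[OF _ a(1)] phi_E[OF x] by simp
  also have "\<dots> < \<infinity>" using fin by (simp add: ennreal_mult_less_top)
  finally show ?thesis using a by (simp add: left_ideal_of_weight_def)
qed

text \<open>The expectations of the positive elements of finite weight lie in \<open>N \<inter> D\<close>, and by
  semi-finiteness those elements span a \<open>\<sigma>\<close>-weakly dense subspace of \<open>M\<close>.\<close>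
lemma eq_0_if_annihilates_N_D:
  assumes T: "T \<in> bounded_ops" and zero: "\<And>d. d \<in> N \<inter> D \<Longrightarrow> T o\<^sub>L d = 0"
  shows "T = 0"
proof -
  have sub: "op.subspace {x \<in> M. T o\<^sub>L E x = 0}"
    unfolding op.subspace_def using M(3,5,8)
    by (auto simp: E_add E_scale compose_distribs compose_scale_op_right T E_D[OF D(8)])
  have "{x \<in> pos_part M. \<phi> x < \<infinity>} \<subseteq> {x \<in> M. T o\<^sub>L E x = 0}"
    using zero E_finite_in_N E_in_D by (auto simp: pos_part_def)
  then have "weight_domain M \<phi> \<subseteq> {x \<in> M. T o\<^sub>L E x = 0}"
    unfolding weight_domain_def using sub by (rule op.span_minimal)
  then show ?thesis
    by (intro eq_0_if_annihilates_expectation_of_dense[OF _ phi_semifinite T]) auto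
qed

section \<open>Support spaces of normalizers\<close>

text \<open>The range of the support projection of \<open>w\<close>.\<close>
definition support_space :: "('h \<Rightarrow>\<^sub>L 'h) \<Rightarrow> 'k set" where
  "support_space w = closure (hilb.span
     {\<pi> s (\<eta> d) | s d. s \<in> bures_closed_bimodule_generated M D E w \<and> d \<in> N \<inter> D})"

lemma supp_op_le_iff:
  "op_le (supp_op M D E \<phi> \<pi> \<eta> u) (supp_op M D E \<phi> \<pi> \<eta> v) \<longleftrightarrow>
     support_space u \<subseteq> support_space v"
proof -
  have "supp_op M D E \<phi> \<pi> \<eta> w = proj_onto (support_space w)" for w
    by (simp add: supp_op_def supp_bimodule_def support_space_def)
  moreover have closed: "closed (support_space w)" and sub: "hilb.subspace (support_space w)" for w
    unfolding support_space_def by (simp_all add: hilb_subspace_closure hilb.subspace_span)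
  ultimately show ?thesis
    using op_le_projection_iff[OF proj_onto(1)[OF closed sub] proj_onto(1)[OF closed sub]]
    by (simp add: proj_onto(2)[OF closed sub])
qed

text \<open>Elements with residual zero form a Bures-closed bimodule containing \<open>v\<close>, hence they include all
  elements \<open>s\<close> of the bimodule generated by \<open>v\<close>, and with them the products \<open>s d\<close>.\<close>
lemma support_space_approximation:
  assumes v: "v \<in> groupoid_normalizer M D"
  shows "support_space v \<subseteq> closure (\<eta> ` {x \<in> N. residual v x = 0})"
  unfolding support_space_def
proof (intro closure_mono hilb.span_minimal)
  let ?K = "{x \<in> N. residual v x = 0}"
  show "hilb.subspace (\<eta> ` ?K)"
    unfolding hilb.subspace_def
  proof (intro conjI ballI allI)
    have "residual v 0 = 0"
      using residual_scale[OF v v_in_M[OF v], of 0] by simp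
    moreover have zN: "0 \<in> N"
      using phi_scale[of 0 0] adj_compose_pos_part[OF M(8)] M(8) by (simp add: left_ideal_of_weight_def)
    ultimately have "0 \<in> ?K" by simp
    moreover have "\<eta> 0 = 0" using eta_diff[OF zN zN] by simp
    ultimately show "0 \<in> \<eta> ` ?K" by (metis imageI)
  next
    fix a b assume "a \<in> \<eta> ` ?K" "b \<in> \<eta> ` ?K"
    then obtain x y where "x \<in> ?K" "y \<in> ?K" "a = \<eta> x" "b = \<eta> y" by blast
    then show "a + b \<in> \<eta> ` ?K"
      using eta_add N_add residual_add[OF v] N_in_M by (intro image_eqI[of _ _ "x + y"]) auto
  next
    fix c a assume "a \<in> \<eta> ` ?K"
    then obtain x where "x \<in> ?K" "a = \<eta> x" by blast
    then show "c *\<^sub>C a \<in> \<eta> ` ?K"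
      using eta_scale N_scale residual_scale[OF v] N_in_M by (intro image_eqI[of _ _ "scale_op c x"]) auto
  qed
  show "{\<pi> s (\<eta> d) | s d. s \<in> bures_closed_bimodule_generated M D E v \<and> d \<in> N \<inter> D} \<subseteq> \<eta> ` ?K"
  proof safe
    fix s d assume s: "s \<in> bures_closed_bimodule_generated M D E v" and d: "d \<in> N" "d \<in> D"
    note sM = generated_bimodule_residual[OF v s]
    have "residual v (s o\<^sub>L d) = 0"
      using residual_bimodule[OF v id_in_D d(2) sM(1)] sM(2) by simp
    then show "\<pi> s (\<eta> d) \<in> \<eta> ` ?K" using pi_eta[OF sM(1) d(1)] N_left[OF sM(1) d(1)] by auto
  qed
qed

text \<open>The residual of \<open>y\<close> is unchanged when an element \<open>x\<close> of residual zero is subtracted from \<open>y\<close>, and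
  \<open>\<eta> x\<close> can be chosen arbitrarily close to \<open>\<eta> y\<close>; contractivity then leaves no room for a
  non-zero residual.\<close>
lemma residual_eq_0_of_support_space:
  assumes v: "v \<in> groupoid_normalizer M D" and y: "y \<in> N" and supp: "\<eta> y \<in> support_space v"
  shows "residual v y = 0"
proof -
  have "norm (\<eta> (residual v y)) \<le> 0 + e" if "0 < e" for e
  proof -
    have "\<eta> y \<in> closure (\<eta> ` {x \<in> N. residual v x = 0})"
      using supp support_space_approximation[OF v] by blast
    then obtain x where x: "x \<in> N" "residual v x = 0" "dist (\<eta> x) (\<eta> y) < e"
      using \<open>0 < e\<close> unfolding closure_approachable by blast
    have "residual v y = residual v (y - x)"
      using residual_diff[OF v N_in_M[OF y] N_in_M[OF x(1)]] x(2) by simp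
    then have "norm (\<eta> (residual v y)) \<le> norm (\<eta> (y - x))"
      using residual_eta_contractive(2)[OF v N_diff[OF y x(1)]] by simp
    also have "\<dots> = dist (\<eta> x) (\<eta> y)"
      by (simp add: eta_diff y x(1) dist_norm norm_minus_commute)
    finally show ?thesis using x(3) by simp
  qed
  then have "norm (\<eta> (residual v y)) \<le> 0" by (rule field_le_epsilon)
  then show ?thesis using eta_eq_0[OF residual_eta_contractive(1)[OF v y]] by simp
qed

text \<open>If \<open>u = v d\<close>, every closed bimodule containing \<open>v\<close> contains \<open>u\<close>. Conversely, the inclusion puts the
  vectors \<open>\<eta> (u d)\<close> into the support space of \<open>v\<close>, so \<open>u d\<close> has residual zero for all
  \<open>d \<in> N \<inter> D\<close>; by the bimodule property the residual of \<open>u\<close> annihilates all these \<open>d\<close>.\<close>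
lemma support_space_subset_iff:
  assumes u: "u \<in> groupoid_normalizer M D" and v: "v \<in> groupoid_normalizer M D"
  shows "support_space u \<subseteq> support_space v \<longleftrightarrow> residual v u = 0"
proof
  note uM = v_in_M[OF u]
  assume "residual v u = 0"
  then obtain d where "d \<in> D" "u = v o\<^sub>L d"
    using normalizer_le_iff_residual[OF v uM] by (auto simp: normalizer_le_def)
  then have "bures_closed_bimodule_generated M D E u \<subseteq> bures_closed_bimodule_generated M D E v"
    using generated_bimodule_mono by blast
  then show "support_space u \<subseteq> support_space v"
    unfolding support_space_def by (intro closure_mono hilb.span_mono) blast
next
  note uM = v_in_M[OF u]
  assume sub: "support_space u \<subseteq> support_space v"
  have "residual v u o\<^sub>L d = 0" if d: "d \<in> N \<inter> D" for d
  proof -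
    have "\<pi> u (\<eta> d) \<in> support_space u"
      unfolding support_space_def
      by (rule subsetD[OF closure_subset], rule hilb.span_base)
        (use d generated_bimodule_self in blast)
    then have "\<eta> (u o\<^sub>L d) \<in> support_space v" using sub d pi_eta[OF uM, of d] by auto
    then have "residual v (u o\<^sub>L d) = 0"
      using residual_eq_0_of_support_space[OF v N_left[OF uM]] d by blast
    then show ?thesis using residual_bimodule[OF v id_in_D _ uM, of d] d by simp
  qed
  then show "residual v u = 0"
    using eq_0_if_annihilates_N_D M(1)[OF residual_in_M[OF v uM]] by blast
qed

end

theorem lemma3p6:
  fixes M D :: "('h::complex_hilbert_space \<Rightarrow>\<^sub>L 'h) set"
    and E :: "('h \<Rightarrow>\<^sub>L 'h) \<Rightarrow> ('h \<Rightarrow>\<^sub>L 'h)"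
    and \<phi> :: "('h \<Rightarrow>\<^sub>L 'h) \<Rightarrow> ennreal"
    and \<pi> :: "('h \<Rightarrow>\<^sub>L 'h) \<Rightarrow> ('k::complex_hilbert_space \<Rightarrow>\<^sub>L 'k)"
    and \<eta> :: "('h \<Rightarrow>\<^sub>L 'h) \<Rightarrow> 'k"
    and u v :: "'h \<Rightarrow>\<^sub>L 'h"
  assumes "cartan_pair M D"
    and "faithful_normal_conditional_expectation M D E"
    and "fns_weight M \<phi>"
    and "\<forall>x\<in>pos_part M. \<phi> (E x) = \<phi> x"
    and "semicyclic_representation M \<phi> \<pi> \<eta>"
    and "u \<in> groupoid_normalizer M D"
    and "v \<in> groupoid_normalizer M D"
  shows "(normalizer_le D u v \<longleftrightarrow> u = v o\<^sub>L E (op_adj v o\<^sub>L u)) \<and>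
    (u = v o\<^sub>L E (op_adj v o\<^sub>L u) \<longleftrightarrow>
      op_le (supp_op M D E \<phi> \<pi> \<eta> u) (supp_op M D E \<phi> \<pi> \<eta> v))"
proof -
  interpret masa_expectation_gns M D E \<phi> \<pi> \<eta>
    by unfold_locales (use assms in \<open>auto simp: cartan_pair_def\<close>)
  have "u = v o\<^sub>L E (op_adj v o\<^sub>L u) \<longleftrightarrow> residual v u = 0" by (simp add: residual_def)
  then show ?thesis
    using normalizer_le_iff_residual[OF assms(7) v_in_M[OF assms(6)]]
      supp_op_le_iff[of u v] support_space_subset_iff[OF assms(6,7)] by blast
qed

end
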